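(* Let $\beta\ge0$. For every $f\in\mathcal{S}$, $\|C_\beta[f]\|\le 4+2\beta$, and this inequality is sharp: equality holds for some $f\in\mathcal{S}$.
   Context: $\mathbb{D}$ is the open unit disk; $\mathcal{A}$ the class of analytic $f$ on $\mathbb{D}$ with $f(0)=0$, $f'(0)=1$; $\mathcal{S}\subset\mathcal{A}$ the univalent functions. For $\beta\ge0$ and $f$ analytic on $\mathbb{D}$ with $f(0)=0$, $C_\beta[f](z)=\int_0^z \frac{f(w)}{w(1-w)^\beta}\,dw$ (principal branch of $(1-w)^\beta$). For $h\in\mathcal{A}$ with $h'$ nonvanishing on $\mathbb{D}$, $\|h\|=\sup_{z\in\mathbb{D}}(1-|z|^2)|h''(z)/h'(z)|$. *)

theory Defs
  imports "HOL-Complex_Analysis.Complex_Analysis"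
begin

definition unit_disk :: "complex set" where
  "unit_disk = ball 0 1"

definition class_A :: "(complex \<Rightarrow> complex) set" where
  "class_A = {f. f holomorphic_on unit_disk \<and> f 0 = 0 \<and> deriv f 0 = 1}"

definition class_S :: "(complex \<Rightarrow> complex) set" where
  "class_S = {f. f \<in> class_A \<and> inj_on f unit_disk}"

text \<open>C_beta[f](z) = integral from 0 to z of f(w) / (w (1-w)^beta) dw, along the
  segment from 0 to z (the disk is convex); complex powr is the principal branch.\<close>
definition C_op :: "real \<Rightarrow> (complex \<Rightarrow> complex) \<Rightarrow> complex \<Rightarrow> complex" where
  "C_op \<beta> f z = contour_integral (linepath 0 z)
      (\<lambda>w. f w / (w * (1 - w) powr (complex_of_real \<beta>)))"

text \<open>Pre-Schwarzian norm, valued in the extended reals so that it may be infinite.\<close>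
definition preS_norm :: "(complex \<Rightarrow> complex) \<Rightarrow> ereal" where
  "preS_norm h = (SUP z\<in>unit_disk.
      ereal ((1 - (cmod z)\<^sup>2) * cmod (deriv (deriv h) z / deriv h z)))"

end

theory Submission
  imports Defs
begin

text \<open>
  Writing \<open>h\<close> for the transform of \<open>f\<close>, one has \<open>h''/h' = f'/f - 1/z + \<beta>/(1-z)\<close>, so everything rests on
  Grunsky's bound \<open>|log (z f'(z)/f(z))| \<le> log ((1+r)/(1-r))\<close>, \<open>r = |z|\<close>, which gives
  \<open>|z f'(z)/f(z) - 1| \<le> 2r/(1-r)\<close>. The Koebe function is extremal along the positive radius.

  For Grunsky's bound at \<open>z = a\<^sup>2\<close>, pass to the odd root transform \<open>k(x) = sqrt (f(x\<^sup>2))\<close> and write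
  \<open>(k(x) - k(a))/(k(x) + k(a)) = T(x) exp (\<kappa>(x))\<close> with \<open>T(x) = (x-a)/(x+a)\<close>; then
  \<open>\<kappa>(a) = log (z f'(z)/f(z))\<close>. As the left-hand side is univalent, its logarithm maps the disc minus small
  neighbourhoods of \<open>a\<close> and \<open>-a\<close> injectively (modulo \<open>2\<pi>i\<close>) into a rectangle, which bounds the integral of
  \<open>|T'/T + \<kappa>'|\<^sup>2\<close> from above. From below, \<open>|\<kappa>'|\<^sup>2 \<ge> 2 Re (cnj (c s) \<kappa>') - |s|\<^sup>2\<close> for unimodular \<open>c\<close>, where
  \<open>s\<close> is the logarithmic derivative of the reflection of \<open>T\<close> in the unit circle, and the integrals
  of \<open>cnj (T'/T) \<kappa>'\<close>, \<open>cnj s \<kappa>'\<close>, \<open>|s|\<^sup>2\<close> and \<open>|T'/T|\<^sup>2\<close> are explicit. The logarithmic divergences cancel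
  and the choice \<open>c = sgn (\<kappa>(a))\<close> remains.
\<close>

section \<open>Area under holomorphic maps and polar coordinates\<close>

text \<open>Grunsky's bound comes from comparing areas. The logarithms of \<open>T\<close> inside
  and outside the disc together cover a rectangle, and univalence confines the logarithm of
  \<open>T exp(\<kappa>)\<close> to a rectangle too. As \<open>T'/T\<close> is not square integrable
  at \<open>a\<close> and \<open>- a\<close>, both areas are infinite and only truncations can be
  compared. Truncating by levels of \<open>|T|\<close> shifts the level for
  \<open>|T exp(\<kappa>)|\<close>, asymptotically by the factor
  \<open>exp (Re \<kappa>(a))\<close>; this matches the term in \<open>Re \<kappa>(a)\<close> coming
  from the cross integral of \<open>T'/T\<close> and \<open>\<kappa>'\<close>, so only the modulus
  of \<open>\<kappa>(a)\<close> survives. The root transform supplies symmetry: with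
  \<open>k\<close> odd, passing from \<open>x\<close> to \<open>- x\<close> inverts the quotient, so
  \<open>\<kappa>\<close> is odd and estimates at the zero \<open>a\<close> carry over to the pole
  \<open>- a\<close>. The cross integrals are evaluated circle by circle with Cauchy's formula for
  \<open>\<kappa>\<close> holomorphic beyond the closed disc, which is why dilated functions are
  treated first.\<close>

lemma lborel_distr_vec2_complex: "distr (lborel :: (real^2) measure) borel (\<lambda>v. Complex (vec_nth v 1) (vec_nth v 2)) = lborel"
proof (rule lborel_eqI[symmetric])
  fix l u :: complex
  assume le: "\<And>b. b \<in> Basis \<Longrightarrow> l \<bullet> b \<le> u \<bullet> b"
  have le2: "Re l \<le> Re u" "Im l \<le> Im u"
    using le[of 1] le[of \<i>] by (auto simp: Basis_complex_def)
  have eq: "(\<lambda>v::real^2. Complex (vec_nth v 1) (vec_nth v 2)) -` box l u = box (vector [Re l, Im l]) (vector [Re u, Im u])"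
    by (auto simp: mem_box Basis_complex_def Basis_vec_def inner_axis UNIV_2 vector_2)
  have "(\<lambda>v::real^2. Complex (vec_nth v 1) (vec_nth v 2)) \<in> borel_measurable borel"
    by (intro borel_measurable_continuous_onI) (auto simp: Complex_eq intro!: continuous_intros)
  then show "emeasure (distr (lborel :: (real^2) measure) borel (\<lambda>v. Complex (vec_nth v 1) (vec_nth v 2))) (box l u) = (\<Prod>b\<in>Basis. (u - l) \<bullet> b)"
    apply (subst emeasure_distr)
    apply (auto simp: eq)
    apply (subst emeasure_lborel_box)
    using le2 apply (auto simp: Basis_complex_def Basis_vec_def inner_axis UNIV_2 vector_2)
    apply (subst prod.insert)
    apply (auto simp: axis_eq_axis inner_axis)
    done
qed simp

lemma lborel_distr_prod_complex: "distr (lborel :: (real \<times> real) measure) borel (\<lambda>(x,y). Complex x y) = lborel"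
proof (rule lborel_eqI[symmetric])
  fix l u :: complex
  assume le: "\<And>b. b \<in> Basis \<Longrightarrow> l \<bullet> b \<le> u \<bullet> b"
  have le2: "Re l \<le> Re u" "Im l \<le> Im u"
    using le[of 1] le[of \<i>] by (auto simp: Basis_complex_def)
  have eq: "(\<lambda>(x,y). Complex x y) -` box l u = box (Re l, Im l) (Re u, Im u)"
    by (auto simp: mem_box Basis_complex_def Basis_prod_def)
  have "(\<lambda>(x,y). Complex x y) \<in> borel_measurable borel"
    by (intro borel_measurable_continuous_onI) (auto simp: Complex_eq case_prod_unfold intro!: continuous_intros)
  then show "emeasure (distr (lborel :: (real \<times> real) measure) borel (\<lambda>(x,y). Complex x y)) (box l u) = (\<Prod>b\<in>Basis. (u - l) \<bullet> b)"
    apply (subst emeasure_distr)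
    apply (auto simp: eq)
    apply (subst emeasure_lborel_box)
    using le2 apply (auto simp: Basis_complex_def Basis_prod_def)
    done
qed simp

text \<open>The image is a preimage under the holomorphic inverse, which is continuous on the open
  image of \<open>S\<close>.\<close>

lemma borel_holomorphic_image:
  assumes S: "open S" and f: "f holomorphic_on S" and inj: "inj_on f S"
    and B: "B \<in> sets borel" "B \<subseteq> S"
  shows "f ` B \<in> sets borel"
proof -
  obtain g where g: "g holomorphic_on (f ` S)" "\<And>z. z \<in> S \<Longrightarrow> g (f z) = z"
    using holomorphic_has_inverse[OF f S inj] by metis
  have op: "open (f ` S)" using open_mapping_thm3[OF f S inj] .
  have eq: "f ` B = {w \<in> f ` S. g w \<in> B}" using g(2) B(2) by force
  have "(\<lambda>w. if w \<in> f ` S then g w else 0) \<in> borel_measurable borel"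
    using holomorphic_on_imp_continuous_on[OF g(1)] op
    by (intro borel_measurable_continuous_on_if) auto
  then have "(\<lambda>w. if w \<in> f ` S then g w else 0) -` B \<inter> space borel \<in> sets borel"
    using B(1) by (rule measurable_sets)
  then have "f ` S \<inter> ((\<lambda>w. if w \<in> f ` S then g w else 0) -` B) \<in> sets borel"
    using op by auto
  also have "f ` S \<inter> ((\<lambda>w. if w \<in> f ` S then g w else 0) -` B) = f ` B"
    unfolding eq by auto
  finally show ?thesis .
qed

lemma borel_measurable_cmod_deriv_square:
  assumes S: "open S" and f: "f holomorphic_on S"
  shows "(\<lambda>z. (cmod (deriv f z))\<^sup>2 * indicator S z) \<in> borel_measurable borel"
proof -
  have "continuous_on S (\<lambda>z. (cmod (deriv f z))\<^sup>2)"
    by (intro continuous_intros holomorphic_on_imp_continuous_on holomorphic_deriv f S)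
  then have "(\<lambda>z. if z \<in> S then (cmod (deriv f z))\<^sup>2 else 0) \<in> borel_measurable borel"
    using S by (intro borel_measurable_continuous_on_if) auto
  also have "(\<lambda>z. if z \<in> S then (cmod (deriv f z))\<^sup>2 else 0) = (\<lambda>z. (cmod (deriv f z))\<^sup>2 * indicator S z)"
    by (auto simp: fun_eq_iff)
  finally show ?thesis .
qed

text \<open>By the Cauchy-Riemann equations the real Jacobian is the squared modulus of the
  derivative. The change of variables is carried out on \<open>real^2\<close>, so \<open>f\<close>
  is conjugated with the coordinate isomorphism \<open>J\<close>.\<close>

lemma emeasure_holomorphic_image:
  assumes S: "open S" and f: "f holomorphic_on S" and inj: "inj_on f S"
    and B: "B \<in> sets borel" "B \<subseteq> S"
  shows "emeasure lborel (f ` B) = (\<integral>\<^sup>+z. ennreal ((cmod (deriv f z))\<^sup>2) * indicator B z \<partial>lborel)"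
proof -
  define J :: "real^2 \<Rightarrow> complex" where "J = (\<lambda>v. Complex (vec_nth v 1) (vec_nth v 2))"
  define K :: "complex \<Rightarrow> real^2" where "K = (\<lambda>z. vector [Re z, Im z])"
  have JK: "J (K z) = z" for z by (simp add: J_def K_def vector_2)
  have KJ: "K (J v) = v" for v by (simp add: J_def K_def vec_eq_iff forall_2 vector_2)
  have linJ: "linear J" unfolding J_def by (rule linearI) (auto simp: complex_eq_iff)
  have linK: "linear K" unfolding K_def by (rule linearI) (auto simp: vec_eq_iff forall_2 vector_2)
  have bl: "bounded_linear J" "bounded_linear K"
    using linJ linK linear_conv_bounded_linear by blast+
  have Jm: "J \<in> borel_measurable borel"
    using bl(1) by (intro borel_measurable_continuous_onI linear_continuous_on)
  have dist: "distr lborel borel J = lborel" unfolding J_def by (rule lborel_distr_vec2_complex)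
  define V where "V = J -` B"
  define \<psi> where "\<psi> = (\<lambda>v. K (f (J v)))"
  define \<psi>' where "\<psi>' = (\<lambda>v h. K (deriv f (J v) * J h))"
  have V: "V \<in> sets borel" using measurable_sets[OF Jm B(1)] by (simp add: V_def)
  have injV: "inj_on \<psi> V"
    using inj B(2) unfolding inj_on_def V_def \<psi>_def
    by (metis JK KJ subsetD vimageD)
  have der: "(\<psi> has_derivative \<psi>' v) (at v within V)" if "v \<in> V" for v
  proof -
    have "J v \<in> S" using that B(2) by (auto simp: V_def)
    then have "(f has_derivative (\<lambda>h. deriv f (J v) * h)) (at (J v))"
      using holomorphic_derivI[OF f S] has_field_derivative_def by blast
    then have "((\<lambda>v. f (J v)) has_derivative (\<lambda>h. deriv f (J v) * J h)) (at v)"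
      using bounded_linear_imp_has_derivative[OF bl(1), of "at v"]
      by (rule has_derivative_compose[rotated])
    then have "(\<psi> has_derivative \<psi>' v) (at v)"
      unfolding \<psi>_def \<psi>'_def
      by (rule bounded_linear.has_derivative[OF bl(2)])
    then show ?thesis by (rule has_derivative_at_withinI)
  qed
  have det: "\<bar>det (matrix (\<psi>' v))\<bar> = (cmod (deriv f (J v)))\<^sup>2" for v
    by (simp add: det_2 matrix_def \<psi>'_def J_def K_def vector_2 axis_def cmod_power2)
       (simp add: power2_eq_square)
  define h where "h = (\<lambda>v. (cmod (deriv f (J v)))\<^sup>2)"
  have hm: "(\<lambda>v. h v * indicator V v) \<in> borel_measurable borel"
  proof -
    have "(\<lambda>z. (cmod (deriv f z))\<^sup>2 * indicator S z * indicator B z) \<in> borel_measurable borel"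
      using borel_measurable_cmod_deriv_square[OF S f] B(1) by measurable
    also have "(\<lambda>z. (cmod (deriv f z))\<^sup>2 * indicator S z * indicator B z) = (\<lambda>z. (cmod (deriv f z))\<^sup>2 * indicator B z)"
      using B(2) by (auto simp: fun_eq_iff indicator_def)
    finally have "(\<lambda>v. (\<lambda>z. (cmod (deriv f z))\<^sup>2 * indicator B z) (J v)) \<in> borel_measurable borel"
      using Jm by (rule measurable_compose[rotated])
    then show ?thesis by (simp add: h_def V_def indicator_def)
  qed
  have im: "J -` (f ` B) = \<psi> ` V"
  proof safe
    fix x b assume "J x = f b" "b \<in> B"
    then show "x \<in> \<psi> ` V"
      by (intro image_eqI[of _ _ "K b"]) (auto simp: \<psi>_def V_def JK, metis KJ)
  qed (auto simp: \<psi>_def V_def JK)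
  have fB: "f ` B \<in> sets borel" by (rule borel_holomorphic_image[OF S f inj B])
  have psiV: "\<psi> ` V \<in> sets borel"
    using measurable_sets[OF Jm fB] by (simp add: im)
  have 1: "emeasure lborel (f ` B) = emeasure lborel (\<psi> ` V)"
    by (subst dist[symmetric], subst emeasure_distr) (use Jm fB im in auto)
  have 2: "(\<integral>\<^sup>+z. ennreal ((cmod (deriv f z))\<^sup>2) * indicator B z \<partial>lborel) = (\<integral>\<^sup>+v. ennreal (h v) * indicator V v \<partial>lborel)"
  proof (subst dist[symmetric], subst nn_integral_distr)
    show "(\<lambda>z. ennreal ((cmod (deriv f z))\<^sup>2) * indicator B z) \<in> borel_measurable (distr lborel borel J)"
    proof -
      have "(\<lambda>z. ennreal ((cmod (deriv f z))\<^sup>2 * indicator S z) * indicator B z) \<in> borel_measurable borel"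
        using borel_measurable_cmod_deriv_square[OF S f] B(1) by measurable
      also have "(\<lambda>z. ennreal ((cmod (deriv f z))\<^sup>2 * indicator S z) * indicator B z) = (\<lambda>z. ennreal ((cmod (deriv f z))\<^sup>2) * indicator B z)"
        using B(2) by (auto simp: fun_eq_iff indicator_def)
      finally show ?thesis by simp
    qed
  qed (use Jm in \<open>auto simp: h_def V_def indicator_def intro!: nn_integral_cong\<close>)
  have key: "\<psi> ` V \<in> lmeasurable \<and> measure lebesgue (\<psi> ` V) = m \<longleftrightarrow> (h has_integral m) V" for m
    using has_measure_differentiable_image[of V \<psi> \<psi>' m] V der injV by (simp add: det h_def)
  have "emeasure lborel (\<psi> ` V) = (\<integral>\<^sup>+v. ennreal (h v) * indicator V v \<partial>lborel)"
  proof (cases "\<psi> ` V \<in> lmeasurable")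
    case True
    then have "(h has_integral measure lebesgue (\<psi> ` V)) V" using key by blast
    then have "(\<integral>\<^sup>+v. ennreal (h v) * indicator V v \<partial>lborel) = measure lebesgue (\<psi> ` V)"
      by (intro nn_integral_has_integral_lebesgue') (auto simp: h_def)
    also have "\<dots> = emeasure lborel (\<psi> ` V)"
      using emeasure_eq_ennreal_measure[OF fmeasurableD2[OF True]] psiV by (simp add: measure_def)
    finally show ?thesis by simp
  next
    case False
    have "emeasure lborel (\<psi> ` V) = \<infinity>"
      using False psiV less_top[of "emeasure lborel (\<psi> ` V)"] by (auto simp: fmeasurable_def)
    moreover have "(\<integral>\<^sup>+v. ennreal (h v) * indicator V v \<partial>lborel) = \<infinity>"
    \<comment> \<open>The equivalence \<open>key\<close> concerns finite measures only. A finite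
      integral would be a Henstock-Kurzweil integral over \<open>V\<close>, and \<open>key\<close>
      would then make the image measurable with finite area.\<close>
    proof (rule ccontr)
      assume fin: "\<not> ?thesis"
      have "(\<integral>\<^sup>+v. ennreal (h v) * indicator V v \<partial>lborel) = (\<integral>\<^sup>+v. ennreal (h v * indicator V v) \<partial>lborel)"
        by (intro nn_integral_cong) (simp add: indicator_def)
      with fin obtain r where r: "(\<integral>\<^sup>+v. ennreal (h v * indicator V v) \<partial>lborel) = ennreal r" "r \<ge> 0"
        by (cases "\<integral>\<^sup>+v. ennreal (h v * indicator V v) \<partial>lborel") auto
      have "((\<lambda>v. h v * indicator V v) has_integral r) UNIV"
        using hm r by (intro nn_integral_has_integral) (auto simp: h_def)
      moreover have "(\<lambda>v. h v * indicator V v) = (\<lambda>v. if v \<in> V then h v else 0)"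
        by (auto simp: fun_eq_iff)
      ultimately have "(h has_integral r) V"
        using has_integral_restrict_UNIV by metis
      then show False using key False by blast
    qed
    ultimately show ?thesis by simp
  qed
  with 1 2 show ?thesis by simp
qed

section \<open>Polar coordinates as the change of variables \<open>z = exp u\<close>\<close>

lemma null_sets_nonpos_Reals: "\<real>\<^sub>\<le>\<^sub>0 \<in> null_sets (lborel :: complex measure)"
proof -
  have "negligible {z. \<i> \<bullet> z = 0}"
    by (rule negligible_hyperplane) auto
  moreover have "\<real>\<^sub>\<le>\<^sub>0 \<subseteq> {z. \<i> \<bullet> z = 0}"
    by (auto simp: complex_nonpos_Reals_iff inner_complex_def)
  ultimately have "negligible (\<real>\<^sub>\<le>\<^sub>0 :: complex set)"
    using negligible_subset by blast
  then show ?thesis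
    using closed_nonpos_Reals_complex by (simp add: negligible_iff_null_sets null_sets_completion_iff borel_closed)
qed

lemma null_sets_nonneg_Reals: "\<real>\<^sub>\<ge>\<^sub>0 \<in> null_sets (lborel :: complex measure)"
proof -
  have "negligible {z. \<i> \<bullet> z = 0}"
    by (rule negligible_hyperplane) auto
  moreover have "\<real>\<^sub>\<ge>\<^sub>0 \<subseteq> {z. \<i> \<bullet> z = 0}"
    by (auto simp: complex_nonneg_Reals_iff inner_complex_def)
  ultimately have "negligible (\<real>\<^sub>\<ge>\<^sub>0 :: complex set)"
    using negligible_subset by blast
  then show ?thesis
    using closed_nonneg_Reals_complex by (simp add: negligible_iff_null_sets null_sets_completion_iff borel_closed)
qed

text \<open>Polar coordinates with the logarithm of the radius as coordinate become an instance of
  the area formula: \<open>exp\<close> is injective on the open strip, has Jacobian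
  \<open>exp (2 * Re u)\<close>, and omits only the nonnegative half-line, a null set.\<close>

lemma lborel_eq_distr_exp:
  "distr (density lborel (\<lambda>u. ennreal (exp (2 * Re u)) * indicator {u. 0 < Im u \<and> Im u < 2 * pi} u)) borel exp
     = (lborel :: complex measure)"
proof (rule measure_eqI)
  let ?S = "{u::complex. 0 < Im u \<and> Im u < 2 * pi}"
  let ?M = "density lborel (\<lambda>u. ennreal (exp (2 * Re u)) * indicator ?S u)"
  have S: "open ?S"
    by (intro open_Collect_conj open_Collect_less continuous_intros)
  have injS: "inj_on exp ?S"
  proof (rule inj_onI)
    fix x y :: complex assume "x \<in> ?S" "y \<in> ?S" and e: "exp x = exp y"
    then have "\<bar>Im x - Im y\<bar> < 2 * pi" by auto
    with e show "x = y" by (metis complex_eqI exp_complex_eqI)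
  qed
  have Smeas [measurable]: "?S \<in> sets borel" using S by simp
  have dm [measurable]: "(\<lambda>u::complex. ennreal (exp (2 * Re u)) * indicator ?S u) \<in> borel_measurable borel"
    by measurable
  have expm [measurable]: "(exp :: complex \<Rightarrow> complex) \<in> borel_measurable borel"
    by (intro borel_measurable_continuous_onI continuous_intros)
  fix A assume "A \<in> sets (distr ?M borel exp)"
  then have A [measurable]: "A \<in> sets (borel :: complex measure)" by simp
  let ?B = "?S \<inter> exp -` A"
  have "exp -` A \<in> sets (borel :: complex measure)"
    using measurable_sets[OF expm A] by simp
  then have B: "?B \<in> sets borel" by simp
  have "emeasure (distr ?M borel exp) A = emeasure ?M (exp -` A)"
    by (subst emeasure_distr) auto
  also have "\<dots> = (\<integral>\<^sup>+u. ennreal (exp (2 * Re u)) * indicator ?S u * indicator (exp -` A) u \<partial>lborel)"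
    using \<open>exp -` A \<in> sets borel\<close> by (subst emeasure_density) auto
  also have "\<dots> = (\<integral>\<^sup>+u. ennreal ((cmod (deriv exp u))\<^sup>2) * indicator ?B u \<partial>lborel)"
    by (intro nn_integral_cong) (auto simp: indicator_def power2_eq_square DERIV_imp_deriv[OF DERIV_exp] mult_exp_exp)
  also have "\<dots> = emeasure lborel (exp ` ?B)"
    by (rule emeasure_holomorphic_image[OF S _ injS B, symmetric]) (auto intro: holomorphic_intros)
  also have "exp ` ?B = A - \<real>\<^sub>\<ge>\<^sub>0"
  proof safe
    fix u :: complex assume u: "0 < Im u" "Im u < 2 * pi" "exp u \<in> \<real>\<^sub>\<ge>\<^sub>0"
    \<comment> \<open>The shift moves \<open>u\<close> into the principal strip, where
      \<open>Ln\<close> inverts \<open>exp\<close>. On the negative half-line \<open>Ln\<close> has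
      imaginary part exactly \<open>pi\<close>, which the open strip excludes.\<close>
    define v where "v = u - \<i> * pi"
    have v: "\<bar>Im v\<bar> < pi" using u by (auto simp: v_def abs_less_iff)
    have "exp v = - exp u" by (simp add: v_def exp_diff)
    then have "Re (exp v) < 0" "Im (exp v) = 0"
      using u(3) exp_not_eq_zero[of u] complex_eq_iff[of "exp u" 0]
      by (auto simp: complex_nonneg_Reals_iff simp del: exp_not_eq_zero)
    then have "Im (Ln (exp v)) = pi" using Im_Ln_eq_pi[of "exp v"] by simp
    moreover have "Ln (exp v) = v" using v by simp
    ultimately show False using v by simp
  next
    fix w assume w: "w \<in> A" "w \<notin> \<real>\<^sub>\<ge>\<^sub>0"
    then have "w \<noteq> 0" by auto
    define u where "u = Ln (- w) + \<i> * pi"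
    have "w = exp u" using \<open>w \<noteq> 0\<close> by (simp add: u_def exp_add)
    moreover have "0 < Im u" "Im u < 2 * pi"
      using w \<open>w \<noteq> 0\<close> Im_Ln_less_pi[of "- w"] mpi_less_Im_Ln[of "- w"]
      by (auto simp: u_def complex_nonpos_Reals_iff complex_nonneg_Reals_iff)
    ultimately show "w \<in> exp ` ?B" using w by blast
  qed
  also have "emeasure lborel (A - \<real>\<^sub>\<ge>\<^sub>0) = emeasure lborel A"
    by (rule emeasure_Diff_null_set[OF null_sets_nonneg_Reals]) simp
  finally show "emeasure (distr ?M borel exp) A = emeasure lborel A" .
qed simp

lemma lborel_eq_distr_polar:
  "distr (density (lborel \<Otimes>\<^sub>M lborel) (\<lambda>(x,y). ennreal (exp (2 * x) * indicator {0<..<2*pi} y))) borel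
      (\<lambda>(x,y). exp (Complex x y)) = lborel"
proof -
  let ?C = "\<lambda>(x,y). Complex x y"
  have C [measurable]: "?C \<in> borel_measurable (lborel \<Otimes>\<^sub>M lborel)"
    unfolding lborel_prod
    by (simp, intro borel_measurable_continuous_onI) (auto simp: Complex_eq case_prod_unfold intro!: continuous_intros)
  have expm [measurable]: "(exp :: complex \<Rightarrow> complex) \<in> borel_measurable borel"
    by (intro borel_measurable_continuous_onI continuous_intros)
  have S: "open {u::complex. 0 < Im u \<and> Im u < 2 * pi}"
    by (intro open_Collect_conj open_Collect_less continuous_intros)
  then have Smeas [measurable]: "{u::complex. 0 < Im u \<and> Im u < 2 * pi} \<in> sets borel" by simp
  have "lborel = distr (density (distr (lborel \<Otimes>\<^sub>M lborel) borel ?C) (\<lambda>u. ennreal (exp (2 * Re u)) * indicator {u. 0 < Im u \<and> Im u < 2 * pi} u)) borel exp"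
    by (simp only: lborel_prod lborel_distr_prod_complex lborel_eq_distr_exp)
  also have "density (distr (lborel \<Otimes>\<^sub>M lborel) borel ?C) (\<lambda>u. ennreal (exp (2 * Re u)) * indicator {u. 0 < Im u \<and> Im u < 2 * pi} u)
     = distr (density (lborel \<Otimes>\<^sub>M lborel) (\<lambda>p. ennreal (exp (2 * Re (?C p))) * indicator {u. 0 < Im u \<and> Im u < 2 * pi} (?C p))) borel ?C"
    by (subst density_distr) auto
  also have "(\<lambda>p. ennreal (exp (2 * Re (?C p))) * indicator {u. 0 < Im u \<and> Im u < 2 * pi} (?C p)) = 
     (\<lambda>(x,y). ennreal (exp (2 * x) * indicator {0<..<2*pi} y))"
    by (auto simp: fun_eq_iff indicator_def)
  also have "distr (distr (density (lborel \<Otimes>\<^sub>M lborel) (\<lambda>(x,y). ennreal (exp (2 * x) * indicator {0<..<2*pi} y))) borel ?C) borel exp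
     = distr (density (lborel \<Otimes>\<^sub>M lborel) (\<lambda>(x,y). ennreal (exp (2 * x) * indicator {0<..<2*pi} y))) borel (exp \<circ> ?C)"
    by (intro distr_distr) auto
  also have "exp \<circ> ?C = (\<lambda>(x,y). exp (Complex x y))" by (auto simp: fun_eq_iff)
  finally show ?thesis by simp
qed

lemma borel_measurable_exp_Complex:
  "(\<lambda>(x,y). exp (Complex x y)) \<in> borel_measurable (lborel \<Otimes>\<^sub>M lborel)"
    unfolding lborel_prod
    by (simp, intro borel_measurable_continuous_onI) (auto simp: Complex_eq case_prod_unfold intro!: continuous_intros)

lemma nn_integral_polar:
  assumes [measurable]: "F \<in> borel_measurable borel"
  shows "(\<integral>\<^sup>+z. F z \<partial>lborel) = (\<integral>\<^sup>+x. \<integral>\<^sup>+y. ennreal (exp (2 * x) * indicator {0<..<2*pi} y) * F (exp (Complex x y)) \<partial>lborel \<partial>lborel)"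
proof -
  note [measurable] = borel_measurable_exp_Complex
  have m1: "(\<lambda>(x,y). ennreal (exp (2 * x) * indicator {0<..<2*pi} y)) \<in> borel_measurable (lborel \<Otimes>\<^sub>M (lborel :: real measure))"
    by measurable
  have m2: "(\<lambda>p. F (case p of (x,y) \<Rightarrow> exp (Complex x y))) \<in> borel_measurable (lborel \<Otimes>\<^sub>M lborel)"
    by measurable
  have "(\<integral>\<^sup>+z. F z \<partial>lborel) = (\<integral>\<^sup>+p. (case p of (x,y) \<Rightarrow> ennreal (exp (2 * x) * indicator {0<..<2*pi} y)) * F (case p of (x,y) \<Rightarrow> exp (Complex x y)) \<partial>(lborel \<Otimes>\<^sub>M lborel))"
    apply (subst lborel_eq_distr_polar[symmetric])
    apply (subst nn_integral_distr)
      apply simp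
     apply simp
    apply (subst nn_integral_density)
    using m1 m2 by auto
  also have "\<dots> = (\<integral>\<^sup>+x. \<integral>\<^sup>+y. ennreal (exp (2 * x) * indicator {0<..<2*pi} y) * F (exp (Complex x y)) \<partial>lborel \<partial>lborel)"
    apply (subst lborel.nn_integral_fst[symmetric])
    using m1 m2 by auto
  finally show ?thesis .
qed

lemma integral_polar:
  fixes F :: "complex \<Rightarrow> complex"
  assumes F: "integrable lborel F"
  shows "integrable lborel (\<lambda>x. LINT y|lborel. (exp (2 * x) * indicator {0<..<2*pi} y) *\<^sub>R F (exp (Complex x y)))"
   and "integral\<^sup>L lborel F = (LINT x|lborel. LINT y|lborel. (exp (2 * x) * indicator {0<..<2*pi} y) *\<^sub>R F (exp (Complex x y)))"
proof -
  note [measurable] = borel_measurable_exp_Complex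
  have Fm [measurable]: "F \<in> borel_measurable borel"
    using borel_measurable_integrable[OF F] by simp
  let ?d = "\<lambda>(x::real,y). exp (2 * x) * indicator {0<..<2*pi} y :: real"
  let ?G = "\<lambda>(x,y). (exp (2 * x) * indicator {0<..<2*pi} y) *\<^sub>R F (exp (Complex x y))"
  have m1: "?d \<in> borel_measurable (lborel \<Otimes>\<^sub>M (lborel :: real measure))"
    by measurable
  have m2: "(\<lambda>p. F (case p of (x,y) \<Rightarrow> exp (Complex x y))) \<in> borel_measurable (lborel \<Otimes>\<^sub>M lborel)"
    by measurable
  let ?N = "density (lborel \<Otimes>\<^sub>M lborel) ?d"
  have N: "distr ?N borel (\<lambda>(x,y). exp (Complex x y)) = lborel"
    using lborel_eq_distr_polar by (simp add: case_prod_unfold)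
  have m3: "(\<lambda>(x,y). exp (Complex x y)) \<in> measurable ?N borel" by simp
  have "integrable ?N (\<lambda>p. F (case p of (x,y) \<Rightarrow> exp (Complex x y)))"
    using integrable_distr[OF m3, of F] F by (simp add: N)
  then have "integrable (lborel \<Otimes>\<^sub>M lborel) (\<lambda>p. ?d p *\<^sub>R F (case p of (x,y) \<Rightarrow> exp (Complex x y)))"
    using m1 m2 by (subst (asm) integrable_density) auto
  then have G: "integrable (lborel \<Otimes>\<^sub>M lborel) ?G"
    by (simp add: case_prod_unfold)
  show "integrable lborel (\<lambda>x. LINT y|lborel. (exp (2 * x) * indicator {0<..<2*pi} y) *\<^sub>R F (exp (Complex x y)))"
    using lborel_pair.integrable_fst'[OF G] by simp
  have "integral\<^sup>L lborel F = integral\<^sup>L ?N (\<lambda>p. F (case p of (x,y) \<Rightarrow> exp (Complex x y)))"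
    by (subst N[symmetric], subst integral_distr) auto
  also have "\<dots> = (LINT p|(lborel \<Otimes>\<^sub>M lborel). ?d p *\<^sub>R F (case p of (x,y) \<Rightarrow> exp (Complex x y)))"
    using m1 m2 by (subst integral_density) auto
  also have "\<dots> = integral\<^sup>L (lborel \<Otimes>\<^sub>M lborel) ?G"
    by (simp add: case_prod_unfold)
  also have "\<dots> = (LINT x|lborel. LINT y|lborel. (exp (2 * x) * indicator {0<..<2*pi} y) *\<^sub>R F (exp (Complex x y)))"
    using lborel_pair.integral_fst'[OF G] by simp
  finally show "integral\<^sup>L lborel F = (LINT x|lborel. LINT y|lborel. (exp (2 * x) * indicator {0<..<2*pi} y) *\<^sub>R F (exp (Complex x y)))" .
qed

section \<open>Kernel integrals over the unit disc\<close>

lemma exp_Complex: "exp (Complex x y) = of_real (exp x) * cis y"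
  by (simp add: exp_eq_polar)

text \<open>On a circle about the origin \<open>dz = \<i> z d\<theta>\<close>, so splitting off a
  factor \<open>z\<close> turns an angular integral into a contour integral. In the applications
  \<open>F\<close> involves \<open>cnj z\<close> and is not holomorphic; \<open>G\<close> is a
  function that agrees with \<open>F z / z\<close> on this one circle, where \<open>cnj z\<close> is
  a multiple of \<open>1 / z\<close>, and is accessible to Cauchy's formula.\<close>

lemma circle_integral_polar:
  assumes cont: "continuous_on (sphere 0 (exp x)) F"
    and I: "(G has_contour_integral I) (circlepath 0 (exp x))"
    and FG: "\<And>z. cmod z = exp x \<Longrightarrow> F z = z * G z"
  shows "(LINT y|lborel. (exp (2 * x) * indicator {0<..<2*pi} y) *\<^sub>R F (exp (Complex x y))) = exp (2 * x) *\<^sub>R (I / \<i>)"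
proof -
  let ?g = "\<lambda>y. F (exp (Complex x y))"
  have "((\<lambda>t. G (0 + exp x * cis t) * exp x * \<i> * cis t) has_integral I) {0..2*pi}"
    using I by (simp add: circlepath_def has_contour_integral_part_circlepath_iff)
  then have "((\<lambda>t. inverse \<i> * (G (0 + exp x * cis t) * exp x * \<i> * cis t)) has_integral inverse \<i> * I) {0..2*pi}"
    by (rule has_integral_mult_right)
  also have "(\<lambda>t. inverse \<i> * (G (0 + exp x * cis t) * exp x * \<i> * cis t)) = ?g"
    by (auto simp: fun_eq_iff exp_Complex FG norm_mult algebra_simps)
  finally have hi: "(?g has_integral (I / \<i>)) {0..2*pi}" by (simp add: field_simps)
  have "continuous_on {0..2*pi} ?g"
    by (intro continuous_on_compose2[OF cont]) 
       (auto simp: exp_Complex norm_mult intro!: continuous_intros)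
  then have "set_integrable lborel {0..2*pi} ?g"
    by (rule borel_integrable_atLeastAtMost')
  then have si: "set_integrable lborel {0<..<2*pi} ?g"
    by (rule set_integrable_subset) auto
  have "(LINT y:{0<..<2*pi}|lborel. ?g y) = integral {0<..<2*pi} ?g"
    by (rule set_borel_integral_eq_integral(2)[OF si])
  also have "\<dots> = I / \<i>" using hi has_integral_Icc_iff_Ioo integral_unique by blast
  finally have "(LINT y:{0<..<2*pi}|lborel. ?g y) = I / \<i>" .
  then show ?thesis
    unfolding set_lebesgue_integral_def
    by (simp only: scaleR_scaleR[symmetric] integral_scaleR_right)
qed

lemma holomorphic_on_derivative:
  assumes S: "open S" and K: "\<And>z. z \<in> S \<Longrightarrow> (K has_field_derivative k z) (at z)"
  shows "k holomorphic_on S"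
proof (rule holomorphic_transform)
  show "deriv K holomorphic_on S"
    using S K by (intro holomorphic_deriv) (auto simp: holomorphic_on_open)
  show "deriv K z = k z" if "z \<in> S" for z using K[OF that] by (rule DERIV_imp_deriv)
qed

text \<open>Cauchy's formula on the circle of radius \<open>exp x\<close> yields angular integrals
  of the form \<open>H x\<close>, which is the derivative of \<open>K (c * exp (2 * x))\<close> in
  \<open>x\<close>; the radial integral is therefore a difference of boundary values, with
  \<open>K 0\<close> coming from \<open>x\<close> tending to minus infinity. The cut-off
  \<open>b\<close> is the logarithm of the radius beyond which the circles contribute
  nothing.\<close>

lemma integral_radial_primitive:
  fixes K :: "complex \<Rightarrow> complex"
  assumes K: "\<And>z. z \<in> ball 0 R \<Longrightarrow> (K has_field_derivative k z) (at z)"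
    and c: "cmod c * exp (2 * b) < R"
    and int: "integrable lborel H"
    and H: "\<And>x. x < b \<Longrightarrow> H x = exp (2 * x) *\<^sub>R (2 * c * k (c * complex_of_real (exp (2 * x))))"
    and H0: "\<And>x. x > b \<Longrightarrow> H x = 0"
  shows "integral\<^sup>L lborel H = K (c * complex_of_real (exp (2 * b))) - K 0"
proof -
  have Rpos: "R > 0" using c by (smt (verit) exp_gt_zero norm_ge_zero zero_le_mult_iff)
  define g where "g = (\<lambda>x. exp (2 * x) *\<^sub>R (2 * c * k (c * complex_of_real (exp (2 * x)))))"
  have ins: "c * complex_of_real (exp (2 * x)) \<in> ball 0 R" if "x \<le> b" for x :: real
  proof -
    have "cmod c * exp (2 * x) \<le> cmod c * exp (2 * b)" using that by (intro mult_left_mono) auto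
    then show ?thesis using c by (simp add: norm_mult)
  qed
  have kc: "continuous_on (ball 0 R) k"
    using holomorphic_on_derivative[OF open_ball K] holomorphic_on_imp_continuous_on by blast
  \<comment> \<open>The hypotheses leave the value at \<open>x = b\<close> open, since for the
    Cauchy kernel that circle passes through the pole.\<close>
  have ae: "AE x in lborel. H x = indicator {..<b} x *\<^sub>R g x"
    using AE_lborel_singleton[of b]
  proof eventually_elim
    case (elim x)
    then consider "x < b" | "x > b" by fastforce
    then show ?case by cases (auto simp: H H0 g_def)
  qed
  have gm: "(\<lambda>x. indicator {..<b} x *\<^sub>R g x) \<in> borel_measurable lborel"
  proof -
    have "continuous_on {..<b} g"
      unfolding g_def
      by (intro continuous_intros continuous_on_compose2[OF kc]) (use ins in auto)
    then show ?thesis 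
      using borel_measurable_continuous_on_indicator[of "{..<b}" g] by simp
  qed
  have si: "integrable lborel (\<lambda>x. indicator {..<b} x *\<^sub>R g x)"
    using int integrable_cong_AE[OF borel_measurable_integrable[OF int] gm ae] by simp
  have ei: "einterval (-\<infinity>) (ereal b) = {..<b}" by (auto simp: einterval_def)
  have "(LBINT x=-\<infinity>..ereal b. g x) = K (c * complex_of_real (exp (2 * b))) - K 0"
  proof (rule interval_integral_FTC_integrable)
    show "-\<infinity> < ereal b" by simp
    show "((\<lambda>x. K (c * complex_of_real (exp (2 * x)))) has_vector_derivative g x) (at x)" if "ereal x < ereal b" for x
    proof -
      have "((\<lambda>x. exp (2 * x)) has_field_derivative (exp (2 * x) * 2)) (at x)"
        by (auto intro!: derivative_eq_intros)
      then have "((\<lambda>x. c * complex_of_real (exp (2 * x))) has_vector_derivative (c * complex_of_real (exp (2 * x) * 2))) (at x)"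
        by (intro has_vector_derivative_mult_right has_vector_derivative_of_real)
      moreover have "(K has_field_derivative k (c * complex_of_real (exp (2 * x)))) (at (c * complex_of_real (exp (2 * x))))"
        using ins[of x] that by (intro K) auto
      ultimately have "((K \<circ> (\<lambda>x. c * complex_of_real (exp (2 * x)))) has_vector_derivative ((c * complex_of_real (exp (2 * x) * 2)) * k (c * complex_of_real (exp (2 * x))))) (at x)"
        by (rule field_vector_diff_chain_at)
      then show ?thesis by (simp add: g_def o_def scaleR_conv_of_real algebra_simps)
    qed
    show "isCont g x" if "ereal x < ereal b" for x
    proof -
      have "continuous_on {..<b} g"
        unfolding g_def
        by (intro continuous_intros continuous_on_compose2[OF kc]) (use ins in auto)
      then show ?thesis using that by (simp add: continuous_on_eq_continuous_at)
    qed
    show "set_integrable lborel (einterval (-\<infinity>) (ereal b)) g"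
      using si by (simp add: set_integrable_def ei)
    have isK: "isCont K z" if "z \<in> ball 0 R" for z using K[OF that] DERIV_isCont by blast
    have "((\<lambda>x::real. exp (2 * x)) \<longlongrightarrow> 0) at_bot"
      by real_asymp
    then have "((\<lambda>x. c * complex_of_real (exp (2 * x))) \<longlongrightarrow> c * of_real 0) at_bot"
      by (intro tendsto_intros)
    then have "((\<lambda>x. K (c * complex_of_real (exp (2 * x)))) \<longlongrightarrow> K 0) at_bot"
      using isK[of 0] Rpos by (intro isCont_tendsto_compose[of 0 K]) auto
    then show "(((\<lambda>x. K (c * complex_of_real (exp (2 * x)))) \<circ> real_of_ereal) \<longlongrightarrow> K 0) (at_right (-\<infinity>))"
      by (simp add: ereal_tendsto_simps) 
    have "isCont (\<lambda>x::real. K (c * complex_of_real (exp (2 * x)))) b"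
      using isK[OF ins[of b]] by (intro isCont_o2[of b _ K] continuous_intros) auto
    then have "((\<lambda>x. K (c * complex_of_real (exp (2 * x)))) \<longlongrightarrow> K (c * complex_of_real (exp (2 * b)))) (at_left b)"
      by (meson filterlim_at_split isCont_def)
    then show "(((\<lambda>x. K (c * complex_of_real (exp (2 * x)))) \<circ> real_of_ereal) \<longlongrightarrow> K (c * complex_of_real (exp (2 * b)))) (at_left (ereal b))"
      by (simp add: ereal_tendsto_simps)
  qed
  moreover have "integral\<^sup>L lborel H = (LBINT x=-\<infinity>..ereal b. g x)"
    using integral_cong_AE[OF borel_measurable_integrable[OF int] gm ae]
    by (simp add: interval_lebesgue_integral_def set_lebesgue_integral_def ei)
  ultimately show ?thesis by simp
qed

text \<open>Translating \<open>a\<close> to the origin moves the unit disc into the disc of radius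
  2; there the factor \<open>exp (2 * x)\<close> of polar coordinates leaves \<open>exp x\<close>,
  which is integrable up to \<open>ln 2\<close>.\<close>

lemma integrable_inverse_dist_disc:
  assumes a: "cmod a < 1"
  shows "integrable lborel (\<lambda>z. indicator (ball 0 1) z *\<^sub>R (1 / cmod (z - a)))"
proof (rule integrableI_nonneg)
  let ?F = "\<lambda>z::complex. ennreal (indicator (ball 0 2) z *\<^sub>R (1 / cmod z))"
  have m: "(\<lambda>z::complex. indicator (ball 0 r) z *\<^sub>R (1 / cmod (z - c))) \<in> borel_measurable borel" for r c
    by (intro borel_measurable_scaleR borel_measurable_indicator borel_measurable_divide borel_measurable_norm) auto
  have Fm: "?F \<in> borel_measurable borel" using m[of 2 0] by simp
  have si: "set_integrable lborel (einterval (-\<infinity>) (ereal (ln 2))) (exp :: real \<Rightarrow> real)"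
  proof (rule interval_integral_FTC_nonneg(1))
    show "((exp \<circ> real_of_ereal) \<longlongrightarrow> (0::real)) (at_right (-\<infinity>))"
      using exp_at_bot by (simp add: ereal_tendsto_simps)
    have "isCont (exp :: real \<Rightarrow> real) (ln 2)" by simp
    then have "((exp :: real \<Rightarrow> real) \<longlongrightarrow> 2) (at_left (ln 2))"
      by (metis filterlim_at_split isCont_def exp_ln zero_less_numeral)
    then show "((exp \<circ> real_of_ereal) \<longlongrightarrow> (2::real)) (at_left (ereal (ln 2)))"
      by (simp add: ereal_tendsto_simps)
  qed auto
  have ei: "einterval (-\<infinity>) (ereal (ln 2)) = {..<ln 2}" by (auto simp: einterval_def)
  have nnexp: "(\<integral>\<^sup>+x. ennreal (indicator {..<ln 2} x * exp x) \<partial>lborel) < \<infinity>"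
    using si by (simp add: ei set_integrable_def integrable_iff_bounded abs_mult)
  have "(\<integral>\<^sup>+z. ennreal (indicator (ball 0 1) z *\<^sub>R (1 / cmod (z - a))) \<partial>lborel)
      = (\<integral>\<^sup>+z. ennreal (indicator (ball 0 1) z *\<^sub>R (1 / cmod (z - a))) \<partial>(distr lborel borel ((+) a)))"
    by (simp add: lborel_distr_plus)
  also have "\<dots> = (\<integral>\<^sup>+z. ennreal (indicator (ball 0 1) (a + z) *\<^sub>R (1 / cmod z)) \<partial>lborel)"
    using m[of 1 a] by (subst nn_integral_distr) auto
  also have "\<dots> \<le> (\<integral>\<^sup>+z. ?F z \<partial>lborel)"
  proof (intro nn_integral_mono ennreal_leI)
    fix z
    have "cmod (a + z) < 1 \<Longrightarrow> cmod z < 2"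
      using norm_triangle_ineq4[of "a + z" a] a by simp
    then show "indicator (ball 0 1) (a + z) *\<^sub>R (1 / cmod z) \<le> indicator (ball 0 2) z *\<^sub>R (1 / cmod z)"
      by (auto simp: indicator_def)
  qed
  also have "\<dots> = (\<integral>\<^sup>+x. \<integral>\<^sup>+y. ennreal (exp (2 * x) * indicator {0<..<2*pi} y) * ?F (exp (Complex x y)) \<partial>lborel \<partial>lborel)"
    by (rule nn_integral_polar[OF Fm])
  also have "\<dots> = (\<integral>\<^sup>+x. \<integral>\<^sup>+y. ennreal (indicator {..<ln 2} x * exp x) * indicator {0<..<2*pi} y \<partial>lborel \<partial>lborel)"
  proof (intro nn_integral_cong)
    fix x y :: real
    have "exp x < 2 \<longleftrightarrow> x < ln 2" by (metis exp_less_cancel_iff exp_ln zero_less_numeral)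
    moreover have "exp (2 * x) * (1 / exp x) = exp x" by (simp add: exp_diff[symmetric])
    ultimately show "ennreal (exp (2 * x) * indicator {0<..<2*pi} y) * ?F (exp (Complex x y)) = ennreal (indicator {..<ln 2} x * exp x) * indicator {0<..<2*pi} y"
      by (auto simp: indicator_def exp_Complex norm_mult ennreal_mult'[symmetric])
  qed
  also have "\<dots> = (\<integral>\<^sup>+x. ennreal (indicator {..<ln 2} x * exp x) * ennreal (2 * pi) \<partial>lborel)"
    by (intro nn_integral_cong) (simp add: nn_integral_cmult_indicator)
  also have "\<dots> = (\<integral>\<^sup>+x. ennreal (indicator {..<ln 2} x * exp x) \<partial>lborel) * ennreal (2 * pi)"
    by (rule nn_integral_multc) simp
  also have "\<dots> < \<infinity>"
    using nnexp by (simp add: ennreal_mult_less_top)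
  finally show "(\<integral>\<^sup>+z. ennreal (indicator (ball 0 1) z *\<^sub>R (1 / cmod (z - a))) \<partial>lborel) < \<infinity>" .
  show "(\<lambda>z. indicator (ball 0 1) z *\<^sub>R (1 / cmod (z - a))) \<in> borel_measurable lborel"
    using m[of 1 a] by simp
qed auto

lemma cnj_eq_on_circle: "cmod z = r \<Longrightarrow> z \<noteq> 0 \<Longrightarrow> cnj z = of_real (r\<^sup>2) / z"
  using complex_norm_square[of z] by (simp add: field_simps)

text \<open>On the circle of radius \<open>r\<close> the relation \<open>cnj z = r^2 / z\<close>
  turns the conjugated kernel into \<open>z * a / (z - a * r^2)\<close>. Its pole lies inside every
  circle with \<open>r < 1\<close>, so all of them contribute and the pole moves from
  \<open>0\<close> to \<open>a\<close>.\<close>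

lemma disc_integral_reproducing:
  fixes k K F :: "complex \<Rightarrow> complex"
  assumes R: "R > 1" and K: "\<And>z. z \<in> ball 0 R \<Longrightarrow> (K has_field_derivative k z) (at z)"
    and a: "cmod a < 1"
  defines "F \<equiv> \<lambda>z. indicator (ball 0 1) z *\<^sub>R (k z * cnj (cnj a / (1 - cnj a * z)))"
  shows "integrable lborel F" "integral\<^sup>L lborel F = pi * (K a - K 0)"
proof -
  have kh: "k holomorphic_on ball 0 R" using holomorphic_on_derivative[OF open_ball K] by blast
  have kc: "continuous_on (ball 0 R) k" using kh by (rule holomorphic_on_imp_continuous_on)
  have nz: "1 - a * cnj z \<noteq> 0" if "cmod z \<le> 1" for z
  proof -
    have "cmod a * cmod z \<le> cmod a * 1" using that by (intro mult_left_mono) auto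
    then have "cmod (a * cnj z) < 1" using a by (simp add: norm_mult)
    then show ?thesis by force
  qed
  have cF: "continuous_on (cball 0 1) (\<lambda>z. k z * cnj (cnj a / (1 - cnj a * z)))"
    using R nz by (auto intro!: continuous_intros continuous_on_subset[OF kc])
  have "set_integrable lborel (cball 0 1) (\<lambda>z. k z * cnj (cnj a / (1 - cnj a * z)))"
    unfolding set_integrable_def using cF by (intro borel_integrable_compact) auto
  then have "set_integrable lborel (ball 0 1) (\<lambda>z. k z * cnj (cnj a / (1 - cnj a * z)))"
    by (rule set_integrable_subset) auto
  then show intF: "integrable lborel F" by (simp add: F_def set_integrable_def)
  define H where "H = (\<lambda>x. LINT y|lborel. (exp (2 * x) * indicator {0<..<2*pi} y) *\<^sub>R F (exp (Complex x y)))"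
  have "integral\<^sup>L lborel H = (\<lambda>z. of_real pi * K z) (a * complex_of_real (exp (2 * 0))) - (\<lambda>z. of_real pi * K z) 0"
  proof (rule integral_radial_primitive[where R=R and K="\<lambda>z. of_real pi * K z" and k="\<lambda>z. of_real pi * k z"])
    show "((\<lambda>z. of_real pi * K z) has_field_derivative of_real pi * k z) (at z)" if "z \<in> ball 0 R" for z
      using K[OF that] by (rule DERIV_cmult)
    show "cmod a * exp (2 * 0) < R" using a R by simp
    show "integrable lborel H" unfolding H_def by (rule integral_polar(1)[OF intF])
    show "H x = 0" if "x > 0" for x
    proof -
      have "F (exp (Complex x y)) = 0" for y
        using that by (simp add: F_def indicator_def exp_Complex norm_mult)
      then show ?thesis by (simp add: H_def)
    qed
    fix x :: real assume x: "x < 0"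
    define r where "r = exp x"
    have r: "0 < r" "r < 1" "exp (2 * x) = r\<^sup>2" using x by (auto simp: r_def power2_eq_square mult_exp_exp)
    have "cmod a * r < 1 * 1" using a r by (intro mult_strict_mono) auto
    then have "cmod a * r * r < 1 * r" using r by (intro mult_strict_right_mono) auto
    then have ar: "cmod (a * r\<^sup>2) < r" by (simp add: norm_mult power2_eq_square mult.assoc)
    have "((\<lambda>u. (a * k u) / (u - a * r\<^sup>2)) has_contour_integral (2 * of_real pi * \<i> * (a * k (a * r\<^sup>2)))) (circlepath 0 r)"
      using ar r R by (intro Cauchy_integral_circlepath_simple holomorphic_intros holomorphic_on_subset[OF kh]) auto
    then have "H x = exp (2 * x) *\<^sub>R ((2 * of_real pi * \<i> * (a * k (a * r\<^sup>2))) / \<i>)"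
      unfolding H_def r_def
    proof (rule circle_integral_polar[rotated])
      have "continuous_on (sphere 0 (exp x)) (\<lambda>z. k z * cnj (cnj a / (1 - cnj a * z)))"
        using r by (intro continuous_on_subset[OF cF]) (auto simp: r_def)
      then show "continuous_on (sphere 0 (exp x)) F"
        using r by (auto simp: F_def r_def cong: continuous_on_cong_simp)
    next
      fix z assume z: "cmod z = exp x"
      then have "z \<noteq> 0" by auto
      have "F z = k z * (a / (1 - a * cnj z))" using z r by (simp add: F_def r_def)
      also have "\<dots> = k z * (a / (1 - a * (of_real (r\<^sup>2) / z)))"
        using cnj_eq_on_circle[of z r] z \<open>z \<noteq> 0\<close> by (simp add: r_def)
      also have "\<dots> = z * (a * k z / (z - a * r\<^sup>2))"
        using \<open>z \<noteq> 0\<close> by (simp add: divide_simps)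
      finally show "F z = z * (a * k z / (z - a * (exp x)\<^sup>2))" by (simp add: r_def)
    qed
    then show "H x = exp (2 * x) *\<^sub>R (2 * a * (of_real pi * k (a * complex_of_real (exp (2 * x)))))"
      unfolding r(3) by (simp add: algebra_simps)
  qed
  moreover have "integral\<^sup>L lborel F = integral\<^sup>L lborel H"
    unfolding H_def by (rule integral_polar(2)[OF intF])
  ultimately show "integral\<^sup>L lborel F = pi * (K a - K 0)" by (simp add: algebra_simps)
qed

text \<open>On the circle of radius \<open>r\<close> the conjugated kernel becomes
  \<open>z / (r^2 - cnj a * z)\<close>, with pole at \<open>r^2 / cnj a\<close>. This pole is
  outside the circle for \<open>r > cmod a\<close>, where the integral vanishes, and inside for
  \<open>r < cmod a\<close>; hence the cut-off \<open>b = ln (cmod a)\<close> and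
  \<open>c = 1 / cnj a\<close>. As \<open>r\<close> grows to \<open>cmod a\<close> the pole runs
  from \<open>0\<close> to \<open>a\<close>, and the orientation of the kernel gives the minus
  sign.\<close>

lemma disc_integral_cauchy_kernel:
  fixes k K F :: "complex \<Rightarrow> complex"
  assumes R: "R > 1" and K: "\<And>z. z \<in> ball 0 R \<Longrightarrow> (K has_field_derivative k z) (at z)"
    and a: "a \<noteq> 0" "cmod a < 1"
  defines "F \<equiv> \<lambda>z. indicator (ball 0 1) z *\<^sub>R (k z * cnj (1 / (z - a)))"
  shows "integrable lborel F" "integral\<^sup>L lborel F = - pi * (K a - K 0)"
proof -
  have kh: "k holomorphic_on ball 0 R" using holomorphic_on_derivative[OF open_ball K] by blast
  have kc: "continuous_on (ball 0 R) k" using kh by (rule holomorphic_on_imp_continuous_on)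
  have "compact (k ` cball 0 1)"
    using R by (intro compact_continuous_image continuous_on_subset[OF kc]) auto
  then have "bounded (k ` cball 0 1)" by (rule compact_imp_bounded)
  then obtain C where "\<forall>w\<in>k ` cball 0 1. norm w \<le> C" unfolding bounded_iff by (rule exE)
  then have C: "cmod (k z) \<le> C" if "z \<in> cball 0 1" for z using that by simp
  have C0: "C \<ge> 0" using order_trans[OF norm_ge_zero C[of 0]] by simp
  show intF: "integrable lborel F"
  proof (rule Bochner_Integration.integrable_bound)
    show "integrable lborel (\<lambda>z. C * (indicator (ball 0 1) z *\<^sub>R (1 / cmod (z - a))))"
      by (intro integrable_mult_right integrable_inverse_dist_disc a)
    have "(\<lambda>z. if z \<in> ball 0 1 - {a} then k z * cnj (1 / (z - a)) else 0) \<in> borel_measurable borel"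
      using R by (intro borel_measurable_continuous_on_if continuous_intros continuous_on_subset[OF kc]) auto
    also have "(\<lambda>z. if z \<in> ball 0 1 - {a} then k z * cnj (1 / (z - a)) else 0) = F"
      by (auto simp: fun_eq_iff F_def)
    finally show "F \<in> borel_measurable lborel" by simp
    show "AE z in lborel. norm (F z) \<le> norm (C * (indicator (ball 0 1) z *\<^sub>R (1 / cmod (z - a))))"
      using C C0 by (intro AE_I2) (auto simp: F_def indicator_def norm_divide norm_mult abs_mult
          complex_cnj_diff[symmetric] simp del: complex_cnj_diff intro!: divide_right_mono)
  qed
  define H where "H = (\<lambda>x. LINT y|lborel. (exp (2 * x) * indicator {0<..<2*pi} y) *\<^sub>R F (exp (Complex x y)))"
  define b where "b = ln (cmod a)"
  define c where "c = 1 / cnj a"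
  have eb: "exp b = cmod a" using a by (simp add: b_def)
  have e2b: "exp (2 * b) = (cmod a)\<^sup>2" using eb by (simp add: exp_double)
  have ca: "c * of_real (exp (2 * b)) = a" 
    using a complex_norm_square[of a] unfolding e2b c_def by (simp add: field_simps)
  have b0: "b < 0" using a by (simp add: b_def)
  have "integral\<^sup>L lborel H = (\<lambda>z. - of_real pi * K z) (c * complex_of_real (exp (2 * b))) - (\<lambda>z. - of_real pi * K z) 0"
  proof (rule integral_radial_primitive[where R=R and K="\<lambda>z. - of_real pi * K z" and k="\<lambda>z. - of_real pi * k z"])
    show "((\<lambda>z. - of_real pi * K z) has_field_derivative - of_real pi * k z) (at z)" if "z \<in> ball 0 R" for z
      using K[OF that] by (rule DERIV_cmult)
    have "cmod c * exp (2 * b) = cmod (c * of_real (exp (2 * b)))" by (simp add: norm_mult)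
    also have "\<dots> < R" unfolding ca using a R by simp
    finally show "cmod c * exp (2 * b) < R" .
    show "integrable lborel H" unfolding H_def by (rule integral_polar(1)[OF intF])
    have exR: "exp x < R" if "x < 0" for x
    proof -
      have "exp x < 1" using that by simp
      then show ?thesis using R by linarith
    qed
    have contF: "continuous_on (sphere 0 (exp x)) F" if "x \<noteq> b" "x < 0" for x
    proof -
      have "exp x < R" using that exR by simp
      moreover have "exp x \<noteq> cmod a" using that eb by (metis exp_inj_iff)
      ultimately have "continuous_on (sphere 0 (exp x)) (\<lambda>z. k z * cnj (1 / (z - a)))"
        using that R by (intro continuous_intros continuous_on_subset[OF kc]) auto
      then show ?thesis
        using that by (auto simp: F_def cong: continuous_on_cong_simp)
    qed
    have Fz: "F z = z * (k z / (of_real ((exp x)\<^sup>2) - cnj a * z))" if z: "cmod z = exp x" and x: "x < 0" for x z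
    proof -
      have "z \<noteq> 0" using z by auto
      have "F z = k z * (1 / (cnj z - cnj a))" using z x by (simp add: F_def)
      also have "\<dots> = k z * (1 / (of_real ((exp x)\<^sup>2) / z - cnj a))"
        using cnj_eq_on_circle[of z "exp x"] z \<open>z \<noteq> 0\<close> by simp
      also have "\<dots> = z * (k z / (of_real ((exp x)\<^sup>2) - cnj a * z))"
        using \<open>z \<noteq> 0\<close> by (simp add: divide_simps)
      finally show ?thesis .
    qed
    show "H x = 0" if "x > b" for x
    proof (cases "x < 0")
      case False
      have "F (exp (Complex x y)) = 0" for y
        using False by (simp add: F_def indicator_def exp_Complex norm_mult)
      then show ?thesis by (simp add: H_def)
    next
      case True
      have lt: "cmod a < exp x" using that eb exp_less_mono[of b x] by simp
      have ne: "of_real ((exp x)\<^sup>2) - cnj a * z \<noteq> 0" if "cmod z \<le> exp x" for z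
      proof
        assume "of_real ((exp x)\<^sup>2) - cnj a * z = 0"
        then have "cmod (cnj a * z) = cmod (of_real ((exp x)\<^sup>2))" by simp
        then have "cmod a * cmod z = exp x * exp x" by (simp add: norm_mult power2_eq_square norm_power)
        moreover have "cmod a * cmod z \<le> cmod a * exp x" using that by (intro mult_left_mono) auto
        moreover have "cmod a * exp x < exp x * exp x" using lt by simp
        ultimately show False by linarith
      qed
      have "((\<lambda>z. k z / (of_real ((exp x)\<^sup>2) - cnj a * z)) has_contour_integral 0) (circlepath 0 (exp x))"
      proof (rule Cauchy_theorem_convex_simple)
        have "exp x < R" using True exR by simp
        then show "(\<lambda>z. k z / (of_real ((exp x)\<^sup>2) - cnj a * z)) holomorphic_on cball 0 (exp x)"
          by (intro holomorphic_intros holomorphic_on_subset[OF kh]) (use ne in auto)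
      qed auto
      from circle_integral_polar[OF contF this Fz] True that
      show ?thesis by (simp add: H_def)
    qed
    fix x :: real assume x: "x < b"
    have lt: "exp x < cmod a" using x eb exp_less_mono[of x b] by simp
    define p where "p = c * of_real ((exp x)\<^sup>2)"
    have "cmod p = exp x * (exp x / cmod a)" by (simp add: p_def c_def norm_mult norm_divide power2_eq_square norm_power)
    also have "\<dots> < exp x * 1" using lt a by (intro mult_strict_left_mono) auto
    finally have p: "cmod p < exp x" by simp
    have "exp x < R" using lt a R by linarith
    then have "((\<lambda>u. (- c * k u) / (u - p)) has_contour_integral (2 * of_real pi * \<i> * (- c * k p))) (circlepath 0 (exp x))"
      using p by (intro Cauchy_integral_circlepath_simple holomorphic_intros holomorphic_on_subset[OF kh]) auto
    moreover have "F z = z * ((- c * k z) / (z - p))" if "cmod z = exp x" for z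
    proof -
      have "z \<noteq> p" using p that by auto
      moreover have "of_real ((exp x)\<^sup>2) - cnj a * z = - cnj a * (z - p)"
        using a by (simp add: p_def c_def field_simps)
      ultimately show ?thesis using Fz[OF that] x b0 a by (simp add: c_def field_simps)
    qed
    ultimately have "H x = exp (2 * x) *\<^sub>R ((2 * of_real pi * \<i> * (- c * k p)) / \<i>)"
      unfolding H_def using x b0 by (intro circle_integral_polar[OF contF]) auto
    moreover have "p = c * of_real (exp (2 * x))" by (simp add: p_def exp_double)
    ultimately show "H x = exp (2 * x) *\<^sub>R (2 * c * (- of_real pi * k (c * complex_of_real (exp (2 * x)))))"
      by (simp add: mult_ac)
  qed
  moreover have "integral\<^sup>L lborel F = integral\<^sup>L lborel H"
    unfolding H_def by (rule integral_polar(2)[OF intF])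
  ultimately show "integral\<^sup>L lborel F = - pi * (K a - K 0)" unfolding ca by (simp add: algebra_simps)
qed

section \<open>The Dirichlet integral of a logarithm\<close>

lemma emeasure_closed_rectangle:
  assumes "L \<ge> 0"
  shows "emeasure lborel {u::complex. \<bar>Re u\<bar> \<le> L \<and> \<bar>Im u\<bar> \<le> pi} = ennreal (4 * pi * L)"
proof -
  have eq: "{u::complex. \<bar>Re u\<bar> \<le> L \<and> \<bar>Im u\<bar> \<le> pi} = cbox (Complex (-L) (-pi)) (Complex L pi)"
    by (auto simp: mem_box Basis_complex_def)
  show ?thesis unfolding eq
    by (subst emeasure_lborel_cbox) (use assms in \<open>auto simp: Basis_complex_def mult_ac\<close>)
qed

lemma emeasure_open_rectangle:
  assumes "L \<ge> 0"
  shows "emeasure lborel {u::complex. \<bar>Re u\<bar> < L \<and> \<bar>Im u\<bar> < pi} = ennreal (4 * pi * L)"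
proof -
  have eq: "{u::complex. \<bar>Re u\<bar> < L \<and> \<bar>Im u\<bar> < pi} = box (Complex (-L) (-pi)) (Complex L pi)"
    by (auto simp: mem_box Basis_complex_def)
  show ?thesis unfolding eq
    by (subst emeasure_lborel_box) (use assms in \<open>auto simp: Basis_complex_def mult_ac\<close>)
qed

text \<open>The left side is the area of the image of \<open>A\<close> under the principal logarithm
  of \<open>m\<close>, up to a null set. The image fits into a rectangle of width
  \<open>2 * L\<close> and height \<open>2 * pi\<close>; using the principal branch takes care of
  injectivity modulo \<open>2 * pi * \<i>\<close>.\<close>

lemma nn_integral_log_deriv_le:
  assumes S: "open S" and m: "m holomorphic_on S" and inj: "inj_on m S"
    and nz: "\<And>z. z \<in> S \<Longrightarrow> m z \<noteq> 0"
    and A: "A \<in> sets borel" "A \<subseteq> S" and L: "L \<ge> 0"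
    and bd: "\<And>z. z \<in> A \<Longrightarrow> \<bar>ln (cmod (m z))\<bar> \<le> L"
  shows "(\<integral>\<^sup>+z. ennreal ((cmod (deriv m z / m z))\<^sup>2) * indicator A z \<partial>lborel) \<le> ennreal (4 * pi * L)"
proof -
  define S' where "S' = S \<inter> m -` (- \<real>\<^sub>\<le>\<^sub>0)"
  have S': "open S'" unfolding S'_def
    by (rule continuous_open_preimage[OF holomorphic_on_imp_continuous_on[OF m] S]) auto
  have sub: "S' \<subseteq> S" by (auto simp: S'_def)
  have Lh: "(\<lambda>z. Ln (m z)) holomorphic_on S'"
    by (intro holomorphic_intros holomorphic_on_subset[OF m sub]) (auto simp: S'_def)
  have Li: "inj_on (\<lambda>z. Ln (m z)) S'"
  proof (rule inj_onI)
    fix x y assume xy: "x \<in> S'" "y \<in> S'" "Ln (m x) = Ln (m y)"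
    then have "m x \<noteq> 0" "m y \<noteq> 0" using nz sub by auto
    then have "m x = m y" using xy(3) by (metis exp_Ln)
    then show "x = y" using xy inj sub by (auto simp: inj_on_def)
  qed
  have Ld: "deriv (\<lambda>z. Ln (m z)) z = deriv m z / m z" if "z \<in> S'" for z
  proof -
    have "(m has_field_derivative deriv m z) (at z)"
      using that sub holomorphic_derivI[OF m S] by blast
    then have "((\<lambda>z. Ln (m z)) has_field_derivative (1 / m z * deriv m z)) (at z)"
      using that by (intro derivative_eq_intros refl) (auto simp: S'_def field_simps)
    then show ?thesis by (simp add: DERIV_imp_deriv)
  qed
  \<comment> \<open>The preimage of the branch cut is null: its image lies in a half-line, so the
    area formula makes the integral of the squared derivative over \<open>N\<close> vanish, whereas
    univalence forbids zeros of the derivative.\<close>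
  define N where "N = S - S'"
  have Nb: "N \<in> sets borel" using S S' by (simp add: N_def)
  have N0: "N \<in> null_sets lborel"
  proof -
    have "m ` N \<subseteq> \<real>\<^sub>\<le>\<^sub>0" by (auto simp: N_def S'_def)
    then have "emeasure lborel (m ` N) = 0"
      using null_sets_nonpos_Reals null_sets_subset borel_holomorphic_image[OF S m inj Nb]
      by (metis N_def Diff_subset null_setsD1 sets_lborel)
    then have "(\<integral>\<^sup>+z. ennreal ((cmod (deriv m z))\<^sup>2) * indicator N z \<partial>lborel) = 0"
      using emeasure_holomorphic_image[OF S m inj Nb] by (simp add: N_def)
    moreover have "(\<lambda>z. ennreal ((cmod (deriv m z))\<^sup>2) * indicator N z) \<in> borel_measurable lborel"
    proof -
      have "(\<lambda>z. ennreal ((cmod (deriv m z))\<^sup>2 * indicator S z) * indicator N z) \<in> borel_measurable borel"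
        using borel_measurable_cmod_deriv_square[OF S m] Nb by measurable
      also have "(\<lambda>z. ennreal ((cmod (deriv m z))\<^sup>2 * indicator S z) * indicator N z) = (\<lambda>z. ennreal ((cmod (deriv m z))\<^sup>2) * indicator N z)"
        by (auto simp: fun_eq_iff indicator_def N_def)
      finally show ?thesis by simp
    qed
    ultimately have "AE z in lborel. ennreal ((cmod (deriv m z))\<^sup>2) * indicator N z = 0"
      by (simp add: nn_integral_0_iff_AE)
    then have "AE z in lborel. z \<notin> N"
    proof eventually_elim
      case (elim z)
      have "deriv m z \<noteq> 0" if "z \<in> S"
        using holomorphic_injective_imp_regular[OF m S inj that] .
      then show ?case using elim by (auto simp: N_def indicator_def split: if_splits)
    qed
    then show ?thesis using Nb AE_iff_null_sets[of N lborel] by simp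
  qed
  define B where "B = A \<inter> S'"
  have B: "B \<in> sets borel" "B \<subseteq> S'" using A S' by (auto simp: B_def)
  have "(\<integral>\<^sup>+z. ennreal ((cmod (deriv m z / m z))\<^sup>2) * indicator A z \<partial>lborel)
      = (\<integral>\<^sup>+z. ennreal ((cmod (deriv (\<lambda>z. Ln (m z)) z))\<^sup>2) * indicator B z \<partial>lborel)"
  proof (rule nn_integral_cong_AE)
    show "AE z in lborel. ennreal ((cmod (deriv m z / m z))\<^sup>2) * indicator A z = ennreal ((cmod (deriv (\<lambda>z. Ln (m z)) z))\<^sup>2) * indicator B z"
      using AE_not_in[OF N0]
    proof eventually_elim
      case (elim z)
      then show ?case using A Ld by (auto simp: indicator_def B_def N_def)
    qed
  qed
  also have "\<dots> = emeasure lborel ((\<lambda>z. Ln (m z)) ` B)"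
    by (rule emeasure_holomorphic_image[OF S' Lh Li B, symmetric])
  also have "\<dots> \<le> emeasure lborel {u::complex. \<bar>Re u\<bar> \<le> L \<and> \<bar>Im u\<bar> \<le> pi}"
  proof (rule emeasure_mono)
    have "closed {u::complex. \<bar>Re u\<bar> \<le> L \<and> \<bar>Im u\<bar> \<le> pi}"
      by (intro closed_Collect_conj closed_Collect_le continuous_intros)
    then show "{u::complex. \<bar>Re u\<bar> \<le> L \<and> \<bar>Im u\<bar> \<le> pi} \<in> sets lborel" by simp
    show "(\<lambda>z. Ln (m z)) ` B \<subseteq> {u. \<bar>Re u\<bar> \<le> L \<and> \<bar>Im u\<bar> \<le> pi}"
    proof safe
      fix z assume z: "z \<in> B"
      then have nzz: "m z \<noteq> 0" using B sub nz by blast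
      show "\<bar>Re (Ln (m z))\<bar> \<le> L" using bd[of z] z nzz by (simp add: B_def)
      show "\<bar>Im (Ln (m z))\<bar> \<le> pi"
        using mpi_less_Im_Ln[OF nzz] Im_Ln_le_pi[OF nzz] by (simp add: abs_le_iff)
    qed
  qed
  also have "\<dots> = ennreal (4 * pi * L)" by (rule emeasure_closed_rectangle[OF L])
  finally show ?thesis .
qed

text \<open>The first kernel is the logarithmic derivative of \<open>T\<close>, the second that of
  its reflection. Each is a difference of kernels at \<open>a\<close> and \<open>- a\<close>, so
  \<open>K 0\<close> drops out, and the two values are opposite.\<close>

lemma disc_integral_symmetric_kernels:
  fixes k K :: "complex \<Rightarrow> complex"
  assumes R: "R > 1" and K: "\<And>z. z \<in> ball 0 R \<Longrightarrow> (K has_field_derivative k z) (at z)"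
    and a: "a \<noteq> 0" "cmod a < 1"
  shows "integrable lborel (\<lambda>z. indicator (ball 0 1) z *\<^sub>R (k z * cnj (1 / (z - a) - 1 / (z + a))))"
    "(LINT z|lborel. indicator (ball 0 1) z *\<^sub>R (k z * cnj (1 / (z - a) - 1 / (z + a)))) = - pi * (K a - K (- a))"
    "integrable lborel (\<lambda>z. indicator (ball 0 1) z *\<^sub>R (k z * cnj (cnj a / (1 + cnj a * z) + cnj a / (1 - cnj a * z))))"
    "(LINT z|lborel. indicator (ball 0 1) z *\<^sub>R (k z * cnj (cnj a / (1 + cnj a * z) + cnj a / (1 - cnj a * z)))) = pi * (K a - K (- a))"
proof -
  have b: "- a \<noteq> 0" "cmod (- a) < 1" using a by auto
  note p = disc_integral_cauchy_kernel[OF R K a] disc_integral_cauchy_kernel[OF R K b]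
  have e: "(\<lambda>z. indicator (ball 0 1) z *\<^sub>R (k z * cnj (1 / (z - a) - 1 / (z + a))))
     = (\<lambda>z. indicator (ball 0 1) z *\<^sub>R (k z * cnj (1 / (z - a))) - indicator (ball 0 1) z *\<^sub>R (k z * cnj (1 / (z - (- a)))))"
    by (auto simp: fun_eq_iff algebra_simps indicator_def)
  show "integrable lborel (\<lambda>z. indicator (ball 0 1) z *\<^sub>R (k z * cnj (1 / (z - a) - 1 / (z + a))))"
    unfolding e using p by (intro Bochner_Integration.integrable_diff) auto
  show "(LINT z|lborel. indicator (ball 0 1) z *\<^sub>R (k z * cnj (1 / (z - a) - 1 / (z + a)))) = - pi * (K a - K (- a))"
    unfolding e by (simp only: Bochner_Integration.integral_diff[OF p(1) p(3)] p(2) p(4)) (simp add: algebra_simps)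
  note q = disc_integral_reproducing[OF R K a(2)] disc_integral_reproducing[OF R K b(2)]
  have e: "(\<lambda>z. indicator (ball 0 1) z *\<^sub>R (k z * cnj (cnj a / (1 + cnj a * z) + cnj a / (1 - cnj a * z))))
     = (\<lambda>z. indicator (ball 0 1) z *\<^sub>R (k z * cnj (cnj a / (1 - cnj a * z))) - indicator (ball 0 1) z *\<^sub>R (k z * cnj (cnj (- a) / (1 - cnj (- a) * z))))"
    by (auto simp: fun_eq_iff algebra_simps indicator_def)
  show "integrable lborel (\<lambda>z. indicator (ball 0 1) z *\<^sub>R (k z * cnj (cnj a / (1 + cnj a * z) + cnj a / (1 - cnj a * z))))"
    unfolding e using q by (intro Bochner_Integration.integrable_diff) auto
  show "(LINT z|lborel. indicator (ball 0 1) z *\<^sub>R (k z * cnj (cnj a / (1 + cnj a * z) + cnj a / (1 - cnj a * z)))) = pi * (K a - K (- a))"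
    unfolding e by (simp only: Bochner_Integration.integral_diff[OF q(1) q(3)] q(2) q(4)) (simp add: algebra_simps)
qed

text \<open>At the pole, \<open>mob a (- a) = 0\<close> by the convention for division, so \<open>mob_annulus\<close> avoids both \<open>a\<close> and \<open>- a\<close>.\<close>
definition mob :: "complex \<Rightarrow> complex \<Rightarrow> complex" where
  "mob a z = (z - a) / (z + a)"

definition mob_annulus :: "complex \<Rightarrow> real \<Rightarrow> complex set" where
  "mob_annulus a \<delta> = {z \<in> ball 0 1. \<delta> < cmod (mob a z) \<and> cmod (mob a z) < 1 / \<delta>}"

text \<open>A branch of \<open>log ((1 + cnj a z)/(1 - cnj a z))\<close>. Since \<open>mob a z\<close> equals this quotient at \<open>- a / (cnj a z)\<close>,
  it parametrises the logarithm of \<open>mob a\<close> outside the unit disc.\<close>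
definition reflected_log :: "complex \<Rightarrow> complex \<Rightarrow> complex" where
  "reflected_log a z = Ln (1 + cnj a * z) - Ln (1 - cnj a * z)"

section \<open>The Moebius quotient, its reflection and the logarithmic areas of both\<close>

context
  fixes a :: complex
  assumes a: "a \<noteq> 0" "cmod a < 1"
begin

lemma reflected_log_Re_pos:
  assumes "z \<in> ball 0 (1 / cmod a)"
  shows "Re (1 + cnj a * z) > 0" "Re (1 - cnj a * z) > 0"
proof -
  have "cmod (cnj a * z) < 1" using assms a by (simp add: norm_mult field_simps)
  then have "\<bar>Re (cnj a * z)\<bar> < 1" using abs_Re_le_cmod[of "cnj a * z"] by linarith
  then show "Re (1 + cnj a * z) > 0" "Re (1 - cnj a * z) > 0" by (auto simp: abs_less_iff)
qed

lemma reflected_log_has_derivative: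
  assumes "z \<in> ball 0 (1 / cmod a)"
  shows "(reflected_log a has_field_derivative cnj a / (1 + cnj a * z) + cnj a / (1 - cnj a * z)) (at z)"
proof -
  have "1 + cnj a * z \<notin> \<real>\<^sub>\<le>\<^sub>0" "1 - cnj a * z \<notin> \<real>\<^sub>\<le>\<^sub>0"
    using reflected_log_Re_pos[OF assms] by (auto simp: complex_nonpos_Reals_iff simp del: plus_complex.sel minus_complex.sel)
  then show ?thesis
    unfolding reflected_log_def by (auto intro!: derivative_eq_intros simp: field_simps)
qed

lemma exp_reflected_log:
  assumes "z \<in> ball 0 (1 / cmod a)"
  shows "exp (reflected_log a z) = (1 + cnj a * z) / (1 - cnj a * z)"
proof -
  have "1 + cnj a * z \<noteq> 0" "1 - cnj a * z \<noteq> 0"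
    using reflected_log_Re_pos[OF assms] by (metis less_irrefl zero_complex.sel(1))+
  then show ?thesis by (simp add: reflected_log_def exp_diff)
qed

lemma Im_reflected_log:
  assumes "z \<in> ball 0 (1 / cmod a)"
  shows "\<bar>Im (reflected_log a z)\<bar> < pi"
proof -
  have nz: "1 + cnj a * z \<noteq> 0" "1 - cnj a * z \<noteq> 0"
    using reflected_log_Re_pos[OF assms] by (metis less_irrefl zero_complex.sel(1))+
  have "\<bar>Im (Ln (1 + cnj a * z))\<bar> < pi / 2" "\<bar>Im (Ln (1 - cnj a * z))\<bar> < pi / 2"
    using Re_Ln_pos_lt[OF nz(1)] Re_Ln_pos_lt[OF nz(2)] reflected_log_Re_pos[OF assms] by blast+
  then show ?thesis by (simp add: reflected_log_def)
qed

lemma inj_on_reflected_log: "inj_on (reflected_log a) (ball 0 (1 / cmod a))"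
proof (rule inj_onI)
  fix x y assume x: "x \<in> ball 0 (1 / cmod a)" and y: "y \<in> ball 0 (1 / cmod a)" and eq: "reflected_log a x = reflected_log a y"
  have nz: "1 - cnj a * x \<noteq> 0" "1 - cnj a * y \<noteq> 0"
    using reflected_log_Re_pos(2)[OF x] reflected_log_Re_pos(2)[OF y] by (metis less_irrefl zero_complex.sel(1))+
  have "(1 + cnj a * x) / (1 - cnj a * x) = (1 + cnj a * y) / (1 - cnj a * y)"
    using exp_reflected_log[OF x] exp_reflected_log[OF y] eq by simp
  then have "(1 + cnj a * x) * (1 - cnj a * y) = (1 + cnj a * y) * (1 - cnj a * x)"
    using nz by (simp add: frac_eq_eq)
  then have "cnj a * x = cnj a * y" by (simp add: algebra_simps)
  then show "x = y" using a by simp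
qed

lemma reflected_log_minus: "reflected_log a (- z) = - reflected_log a z"
  by (simp add: reflected_log_def)

lemma reflected_log_self: "reflected_log a a = of_real (ln ((1 + (cmod a)\<^sup>2) / (1 - (cmod a)\<^sup>2)))"
proof -
  have e: "cnj a * a = of_real ((cmod a)\<^sup>2)" using complex_norm_square[of a] by (simp add: mult.commute)
  have pos: "1 - (cmod a)\<^sup>2 > 0" "1 + (cmod a)\<^sup>2 > 0" using a by (auto simp: power_less_one_iff add_pos_nonneg)
  have "1 + cnj a * a = of_real (1 + (cmod a)\<^sup>2)" "1 - cnj a * a = of_real (1 - (cmod a)\<^sup>2)"
    by (simp_all add: e)
  then have "reflected_log a a = of_real (ln (1 + (cmod a)\<^sup>2)) - of_real (ln (1 - (cmod a)\<^sup>2))"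
    unfolding reflected_log_def by (simp only: Ln_of_real[OF pos(1)] Ln_of_real[OF pos(2)])
  then show ?thesis using pos by (simp add: ln_div)
qed

text \<open>The kernel is the derivative of \<open>reflected_log a\<close>, so the reproducing
  formula applied to the kernel itself evaluates its Dirichlet integral as \<open>pi\<close> times
  \<open>reflected_log a a - reflected_log a (- a)\<close>; oddness produces the factor 2. The
  version on the closed disc serves the covering argument, the others the linear estimate for
  \<open>\<kappa>'\<close>.\<close>

lemma nn_integral_reflected_log_deriv:
  "(\<integral>\<^sup>+z. ennreal ((cmod (cnj a / (1 + cnj a * z) + cnj a / (1 - cnj a * z)))\<^sup>2) * indicator (cball 0 1) z \<partial>lborel)
     = ennreal (2 * pi * ln ((1 + (cmod a)\<^sup>2) / (1 - (cmod a)\<^sup>2)))"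
  "integrable lborel (\<lambda>z. indicator (ball 0 1) z *\<^sub>R ((cmod (cnj a / (1 + cnj a * z) + cnj a / (1 - cnj a * z)))\<^sup>2))"
  "(LINT z|lborel. indicator (ball 0 1) z *\<^sub>R ((cmod (cnj a / (1 + cnj a * z) + cnj a / (1 - cnj a * z)))\<^sup>2))
      = 2 * pi * ln ((1 + (cmod a)\<^sup>2) / (1 - (cmod a)\<^sup>2))"
proof -
  let ?s = "\<lambda>z. cnj a / (1 + cnj a * z) + cnj a / (1 - cnj a * z)"
  let ?L = "ln ((1 + (cmod a)\<^sup>2) / (1 - (cmod a)\<^sup>2))"
  have R: "1 / cmod a > 1" using a by simp
  note sk = disc_integral_symmetric_kernels(3,4)[OF R reflected_log_has_derivative a]
  have e: "(\<lambda>z. indicator (ball 0 1) z *\<^sub>R (?s z * cnj (?s z))) = (\<lambda>z. complex_of_real (indicator (ball 0 1) z *\<^sub>R (cmod (?s z))\<^sup>2))"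
    by (auto simp: fun_eq_iff complex_norm_square[symmetric] indicator_def simp del: complex_cnj_add complex_cnj_divide)
  have i: "integrable lborel (\<lambda>z. complex_of_real (indicator (ball 0 1) z *\<^sub>R (cmod (?s z))\<^sup>2))"
    using sk(1) unfolding e .
  then show i2: "integrable lborel (\<lambda>z. indicator (ball 0 1) z *\<^sub>R (cmod (?s z))\<^sup>2)"
    using integrable_Re[OF i] by simp
  have "(LINT z|lborel. complex_of_real (indicator (ball 0 1) z *\<^sub>R (cmod (?s z))\<^sup>2)) = of_real (2 * pi * ?L)"
    using sk(2) unfolding e by (simp add: reflected_log_minus reflected_log_self)
  then show l: "(LINT z|lborel. indicator (ball 0 1) z *\<^sub>R (cmod (?s z))\<^sup>2) = 2 * pi * ?L"
    by (simp only: integral_complex_of_real of_real_eq_iff)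
  have "(\<integral>\<^sup>+z. ennreal (indicator (ball 0 1) z *\<^sub>R (cmod (?s z))\<^sup>2) \<partial>lborel) = ennreal (2 * pi * ?L)"
    unfolding l[symmetric] by (rule nn_integral_eq_integral[OF i2]) auto
  moreover have "(\<integral>\<^sup>+z. ennreal ((cmod (?s z))\<^sup>2) * indicator (cball 0 1) z \<partial>lborel) = (\<integral>\<^sup>+z. ennreal (indicator (ball 0 1) z *\<^sub>R (cmod (?s z))\<^sup>2) \<partial>lborel)"
  proof (rule nn_integral_cong_AE)
    have "sphere 0 1 \<in> null_sets (lborel :: complex measure)"
      using negligible_sphere[of "0::complex" 1] by (simp add: negligible_iff_null_sets null_sets_completion_iff)
    from AE_not_in[OF this]
    show "AE z in lborel. ennreal ((cmod (?s z))\<^sup>2) * indicator (cball 0 1) z = ennreal (indicator (ball 0 1) z *\<^sub>R (cmod (?s z))\<^sup>2)"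
      by eventually_elim (auto simp: indicator_def)
  qed
  ultimately show "(\<integral>\<^sup>+z. ennreal ((cmod (?s z))\<^sup>2) * indicator (cball 0 1) z \<partial>lborel) = ennreal (2 * pi * ?L)"
    by simp
qed

lemma mob_holomorphic: "mob a holomorphic_on (- {- a})"
  unfolding mob_def by (intro holomorphic_intros) (auto simp: add_eq_0_iff2)

lemma inj_on_mob: "inj_on (mob a) (- {- a})"
proof (rule inj_onI)
  fix x y assume "x \<in> - {- a}" "y \<in> - {- a}" "mob a x = mob a y"
  then have "(x - a) * (y + a) = (y - a) * (x + a)"
    by (simp add: mob_def frac_eq_eq add_eq_0_iff2)
  then have "2 * a * x = 2 * a * y" by (simp add: algebra_simps)
  then show "x = y" using a by simp
qed

lemma mob_nonzero: "z \<noteq> a \<Longrightarrow> z \<noteq> - a \<Longrightarrow> mob a z \<noteq> 0"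
  by (simp add: mob_def add_eq_0_iff2)

lemma mob_has_derivative:
  assumes "z \<noteq> a" "z \<noteq> - a"
  shows "(mob a has_field_derivative mob a z * (1 / (z - a) - 1 / (z + a))) (at z)"
proof -
  have nz: "z - a \<noteq> 0" "z + a \<noteq> 0" using assms by (auto simp: add_eq_0_iff2)
  have "(mob a has_field_derivative ((z + a) - (z - a)) / (z + a)\<^sup>2) (at z)"
    unfolding mob_def using nz by (auto intro!: derivative_eq_intros simp: power2_eq_square)
  moreover have "((z + a) - (z - a)) / (z + a)\<^sup>2 = mob a z * (1 / (z - a) - 1 / (z + a))"
    using nz by (simp add: mob_def divide_simps power2_eq_square) 
  ultimately show ?thesis by simp
qed

lemma mob_annulus_avoids:
  assumes "z \<in> mob_annulus a \<delta>" "\<delta> > 0"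
  shows "z \<noteq> a" "z \<noteq> - a" "z \<in> ball 0 1"
  using assms by (auto simp: mob_annulus_def mob_def)

lemma mob_annulus_open:
  assumes "\<delta> > 0" shows "open (mob_annulus a \<delta>)"
proof -
  have "open ((ball 0 1 - {- a}) \<inter> mob a -` {w. \<delta> < cmod w \<and> cmod w < 1 / \<delta>})"
  proof (rule continuous_open_preimage)
    show "continuous_on (ball 0 1 - {- a}) (mob a)"
      using holomorphic_on_imp_continuous_on[OF mob_holomorphic] by (rule continuous_on_subset) auto
    show "open {w::complex. \<delta> < cmod w \<and> cmod w < 1 / \<delta>}"
      by (intro open_Collect_conj open_Collect_less continuous_intros)
  qed auto
  also have "(ball 0 1 - {- a}) \<inter> mob a -` {w. \<delta> < cmod w \<and> cmod w < 1 / \<delta>} = mob_annulus a \<delta>"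
    using mob_annulus_avoids[OF _ assms] by (auto simp: mob_annulus_def)
  finally show ?thesis .
qed

text \<open>This is wanted for finiteness: it makes the truncated integral of
  \<open>|T'/T|^2\<close> a real number that can be subtracted.\<close>

lemma nn_integral_mob_annulus_le:
  assumes d: "0 < \<delta>" "\<delta> < 1"
  shows "(\<integral>\<^sup>+z. ennreal ((cmod (1 / (z - a) - 1 / (z + a)))\<^sup>2) * indicator (mob_annulus a \<delta>) z \<partial>lborel) \<le> ennreal (4 * pi * ln (1 / \<delta>))"
proof -
  let ?S = "ball 0 1 - {a, - a}"
  have "(\<integral>\<^sup>+z. ennreal ((cmod (deriv (mob a) z / mob a z))\<^sup>2) * indicator (mob_annulus a \<delta>) z \<partial>lborel) \<le> ennreal (4 * pi * ln (1 / \<delta>))"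
  proof (rule nn_integral_log_deriv_le)
    show "open ?S" by (intro open_Diff) auto
    show "mob a holomorphic_on ?S" by (rule holomorphic_on_subset[OF mob_holomorphic]) auto
    show "inj_on (mob a) ?S" by (rule inj_on_subset[OF inj_on_mob]) auto
    show "mob_annulus a \<delta> \<in> sets borel" using mob_annulus_open d by simp
    show "mob_annulus a \<delta> \<subseteq> ?S" using mob_annulus_avoids d by auto
    show "ln (1 / \<delta>) \<ge> 0" using d by simp
    fix z assume z: "z \<in> mob_annulus a \<delta>"
    then have "\<delta> < cmod (mob a z)" "cmod (mob a z) < 1 / \<delta>" by (auto simp: mob_annulus_def)
    then have "ln \<delta> < ln (cmod (mob a z))" "ln (cmod (mob a z)) < ln (1 / \<delta>)"
      using d by (auto intro!: ln_less_cancel_iff[THEN iffD2] simp del: ln_less_cancel_iff)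
    then show "\<bar>ln (cmod (mob a z))\<bar> \<le> ln (1 / \<delta>)"
      using d by (simp add: ln_div)
  qed (use mob_nonzero in auto)
  moreover have "(\<integral>\<^sup>+z. ennreal ((cmod (deriv (mob a) z / mob a z))\<^sup>2) * indicator (mob_annulus a \<delta>) z \<partial>lborel)
     = (\<integral>\<^sup>+z. ennreal ((cmod (1 / (z - a) - 1 / (z + a)))\<^sup>2) * indicator (mob_annulus a \<delta>) z \<partial>lborel)"
  proof (intro nn_integral_cong)
    fix z
    show "ennreal ((cmod (deriv (mob a) z / mob a z))\<^sup>2) * indicator (mob_annulus a \<delta>) z = ennreal ((cmod (1 / (z - a) - 1 / (z + a)))\<^sup>2) * indicator (mob_annulus a \<delta>) z"
    proof (cases "z \<in> mob_annulus a \<delta>")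
      case True
      then show ?thesis
        using mob_annulus_avoids[OF True d(1)] mob_nonzero[of z] DERIV_imp_deriv[OF mob_has_derivative[of z]] by simp
    qed auto
  qed
  ultimately show ?thesis by simp
qed

text \<open>The open rectangle is covered by the logarithms of \<open>mob a\<close> inside and outside the disc; the latter
  have the area of the image of the closed disc under \<open>reflected_log a\<close>.\<close>
lemma nn_integral_mob_annulus_ge:
  assumes d: "0 < \<delta>" "\<delta> < 1"
  shows "ennreal (4 * pi * ln (1 / \<delta>)) \<le>
     (\<integral>\<^sup>+z. ennreal ((cmod (1 / (z - a) - 1 / (z + a)))\<^sup>2) * indicator (mob_annulus a \<delta>) z \<partial>lborel)
      + ennreal (2 * pi * ln ((1 + (cmod a)\<^sup>2) / (1 - (cmod a)\<^sup>2)))"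
proof -
  define S where "S = (ball 0 1 - {a, - a}) \<inter> mob a -` (- \<real>\<^sub>\<le>\<^sub>0)"
  have S: "open S" unfolding S_def
  proof (rule continuous_open_preimage)
    show "continuous_on (ball 0 1 - {a, - a}) (mob a)"
      using holomorphic_on_imp_continuous_on[OF mob_holomorphic] by (rule continuous_on_subset) auto
  qed (auto intro!: open_Diff)
  let ?f = "\<lambda>z. Ln (mob a z)"
  have fh: "?f holomorphic_on S"
    by (intro holomorphic_intros holomorphic_on_subset[OF mob_holomorphic]) (auto simp: S_def)
  have fi: "inj_on ?f S"
  proof (rule inj_onI)
    fix x y assume xy: "x \<in> S" "y \<in> S" "?f x = ?f y"
    then have "mob a x \<noteq> 0" "mob a y \<noteq> 0" using mob_nonzero by (auto simp: S_def)
    then have "mob a x = mob a y" using xy(3) by (metis exp_Ln)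
    then show "x = y" using xy inj_on_mob by (auto simp: inj_on_def S_def)
  qed
  have fd: "deriv ?f z = 1 / (z - a) - 1 / (z + a)" if "z \<in> S" for z
  proof -
    have z: "z \<noteq> a" "z \<noteq> - a" "mob a z \<notin> \<real>\<^sub>\<le>\<^sub>0" using that by (auto simp: S_def)
    have "(?f has_field_derivative (1 / mob a z * (mob a z * (1 / (z - a) - 1 / (z + a))))) (at z)"
      by (rule derivative_eq_intros mob_has_derivative z refl)+ (simp add: field_simps)
    then show ?thesis using mob_nonzero[OF z(1,2)] by (simp add: DERIV_imp_deriv)
  qed
  define B where "B = mob_annulus a \<delta> \<inter> S"
  have B: "B \<in> sets borel" "B \<subseteq> S" using mob_annulus_open[OF d(1)] S by (auto simp: B_def)
  have R: "1 / cmod a > 1" using a by simp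
  let ?R = "ball 0 (1 / cmod a)"
  have gh: "reflected_log a holomorphic_on ?R"
    using reflected_log_has_derivative unfolding holomorphic_on_open[OF open_ball] by blast
  have C: "cball 0 1 \<in> sets borel" "cball 0 1 \<subseteq> ?R" using R by auto
  let ?Q = "{u::complex. \<bar>Re u\<bar> < ln (1 / \<delta>) \<and> \<bar>Im u\<bar> < pi}"
  have cover: "?Q \<subseteq> ?f ` B \<union> reflected_log a ` cball 0 1"
  proof
    fix u assume u: "u \<in> ?Q"
    define w where "w = exp u"
    have "cmod w = exp (Re u)" by (simp add: w_def)
    moreover have "exp (Re u) < exp (ln (1 / \<delta>))" "exp (- ln (1 / \<delta>)) < exp (Re u)" using u by (simp_all only: exp_less_cancel_iff) auto
    ultimately have wd: "\<delta> < cmod w" "cmod w < 1 / \<delta>" using d by (simp_all add: exp_minus)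
    have Lw: "Ln w = u" using u by (simp add: w_def abs_less_iff)
    have wn: "w \<notin> \<real>\<^sub>\<le>\<^sub>0"
    proof
      assume "w \<in> \<real>\<^sub>\<le>\<^sub>0"
      moreover have "w \<noteq> 0" by (simp add: w_def)
      ultimately have "Re w < 0" "Im w = 0" by (auto simp: complex_nonpos_Reals_iff complex_eq_iff)
      then have "Im (Ln w) = pi" using \<open>w \<noteq> 0\<close> Im_Ln_eq_pi by blast
      then show False using u by (simp add: Lw)
    qed
    show "u \<in> ?f ` B \<union> reflected_log a ` cball 0 1"
    proof (cases "\<exists>z\<in>ball 0 1. z \<noteq> a \<and> z \<noteq> - a \<and> mob a z = w")
      case True
      then obtain z where z: "z \<in> ball 0 1" "z \<noteq> a" "z \<noteq> - a" "mob a z = w" by blast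
      then have "z \<in> B" using wd wn by (auto simp: B_def S_def mob_annulus_def)
      then show ?thesis using z Lw by (intro UnI1 image_eqI[of _ _ z]) auto
    next
      case False
      \<comment> \<open>This is the solution of
        \<open>(1 + cnj a * x) / (1 - cnj a * x) = w\<close>. If it were outside the closed disc,
        its partner \<open>- a / (cnj a * x)\<close> would lie in the open disc and be mapped to
        \<open>w\<close> by \<open>mob a\<close>, which the case assumption excludes.\<close>
      define x where "x = (w - 1) / ((w + 1) * cnj a)"
      have w1: "w + 1 \<noteq> 0"
      proof
        assume "w + 1 = 0" then have "w = -1" by (simp add: add_eq_0_iff2)
        then show False using wn by simp
      qed
      have xw: "cnj a * x * (w + 1) = w - 1" using w1 a by (simp add: x_def)
      have xin: "x \<in> cball 0 1"
      proof (rule ccontr)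
        assume "x \<notin> cball 0 1"
        then have x1: "cmod x > 1" by simp
        then have x0: "x \<noteq> 0" by auto
        define z where "z = - a / (cnj a * x)"
        have "cmod z = 1 / cmod x" using a by (simp add: z_def norm_divide norm_mult)
        then have zb: "z \<in> ball 0 1" using x1 by (simp add: divide_less_eq)
        have "w \<noteq> 0" by (simp add: w_def)
        have zw: "z * (w - 1) = - a * (w + 1)"
          unfolding xw[symmetric] z_def using a x0 by simp
        have za: "z \<noteq> a" "z \<noteq> - a"
          using zw a \<open>w \<noteq> 0\<close> by (auto simp: algebra_simps)
        have "z + a \<noteq> 0" using za by (simp add: add_eq_0_iff2)
        then have "mob a z = w" using zw by (simp add: mob_def divide_simps algebra_simps)
        then show False using False zb za by blast
      qed
      then have xR: "x \<in> ?R" using C by blast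
      have ne: "1 - cnj a * x \<noteq> 0"
        using reflected_log_Re_pos(2)[OF xR] by (metis less_irrefl zero_complex.sel(1))
      have "exp (reflected_log a x) = (1 + cnj a * x) / (1 - cnj a * x)" by (rule exp_reflected_log[OF xR])
      also have "\<dots> = w" using xw ne by (simp add: divide_simps algebra_simps)
      finally have "exp (reflected_log a x) = exp u" by (simp add: w_def)
      moreover have "\<bar>Im (reflected_log a x) - Im u\<bar> < 2 * pi"
        using Im_reflected_log[OF xR] u by auto
      ultimately have "reflected_log a x = u" by (metis exp_complex_eqI)
      then show ?thesis using xin by blast
    qed
  qed
  have m1: "?f ` B \<in> sets lborel" using borel_holomorphic_image[OF S fh fi B] by simp
  have m2: "reflected_log a ` cball 0 1 \<in> sets lborel"
    using borel_holomorphic_image[OF open_ball gh inj_on_reflected_log C] by simp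
  have "ennreal (4 * pi * ln (1 / \<delta>)) = emeasure lborel ?Q"
    using d by (intro emeasure_open_rectangle[symmetric]) simp
  also have "\<dots> \<le> emeasure lborel (?f ` B \<union> reflected_log a ` cball 0 1)"
    using m1 m2 by (intro emeasure_mono cover) auto
  also have "\<dots> \<le> emeasure lborel (?f ` B) + emeasure lborel (reflected_log a ` cball 0 1)"
    by (rule emeasure_subadditive[OF m1 m2])
  also have "emeasure lborel (reflected_log a ` cball 0 1) = ennreal (2 * pi * ln ((1 + (cmod a)\<^sup>2) / (1 - (cmod a)\<^sup>2)))"
  proof -
    have "emeasure lborel (reflected_log a ` cball 0 1) = (\<integral>\<^sup>+z. ennreal ((cmod (deriv (reflected_log a) z))\<^sup>2) * indicator (cball 0 1) z \<partial>lborel)"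
      by (rule emeasure_holomorphic_image[OF open_ball gh inj_on_reflected_log C])
    also have "\<dots> = (\<integral>\<^sup>+z. ennreal ((cmod (cnj a / (1 + cnj a * z) + cnj a / (1 - cnj a * z)))\<^sup>2) * indicator (cball 0 1) z \<partial>lborel)"
    proof (intro nn_integral_cong)
      fix z
      show "ennreal ((cmod (deriv (reflected_log a) z))\<^sup>2) * indicator (cball 0 1) z = ennreal ((cmod (cnj a / (1 + cnj a * z) + cnj a / (1 - cnj a * z)))\<^sup>2) * indicator (cball 0 1) z"
        using R DERIV_imp_deriv[OF reflected_log_has_derivative[of z]] by (cases "z \<in> cball 0 1") auto
    qed
    finally show ?thesis by (simp only: nn_integral_reflected_log_deriv(1))
  qed
  also have "emeasure lborel (?f ` B) = (\<integral>\<^sup>+z. ennreal ((cmod (deriv ?f z))\<^sup>2) * indicator B z \<partial>lborel)"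
    by (rule emeasure_holomorphic_image[OF S fh fi B])
  also have "\<dots> \<le> (\<integral>\<^sup>+z. ennreal ((cmod (1 / (z - a) - 1 / (z + a)))\<^sup>2) * indicator (mob_annulus a \<delta>) z \<partial>lborel)"
    by (intro nn_integral_mono) (auto simp: fd B_def indicator_def)
  finally show ?thesis by (simp add: add_right_mono)
qed

end

section \<open>The Grunsky inequality\<close>

context
  fixes a :: complex
  assumes a: "a \<noteq> 0" "cmod a < 1"
begin

text \<open>By univalence and the open mapping theorem, small values of the product are taken only
  near its zero \<open>a\<close>, where \<open>exp (\<kappa> z)\<close> is close to
  \<open>exp (\<kappa> a)\<close>. Sublevel sets of the product are thus comparable with those of
  \<open>mob a\<close> up to the factor \<open>exp (- Re (\<kappa> a))\<close>, with
  \<open>\<eta>\<close> absorbing the error.\<close>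

lemma mob_level_inclusion:
  assumes kh: "\<kappa> holomorphic_on ball 0 1"
    and inj: "inj_on (\<lambda>z. mob a z * exp (\<kappa> z)) (ball 0 1 - {- a})"
    and \<eta>: "\<eta> > 0"
  shows "\<exists>e>0. \<forall>z\<in>ball 0 1 - {- a}. \<forall>\<epsilon>. \<epsilon> < e \<longrightarrow> cmod (mob a z * exp (\<kappa> z)) < \<epsilon>
            \<longrightarrow> cmod (mob a z) < \<epsilon> * exp (\<eta> - Re (\<kappa> a))"
proof -
  let ?m = "\<lambda>z. mob a z * exp (\<kappa> z)"
  let ?S = "ball 0 1 - {- a}"
  have oS: "open ?S" by (intro open_Diff) auto
  have aS: "a \<in> ?S" using a by (auto simp: eq_neg_iff_add_eq_0)
  have mh: "?m holomorphic_on ?S"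
    by (intro holomorphic_intros holomorphic_on_subset[OF mob_holomorphic[OF a]] holomorphic_on_subset[OF kh]) auto
  have "isCont \<kappa> a"
    using holomorphic_on_imp_continuous_on[OF kh] a by (simp add: continuous_on_eq_continuous_at)
  then obtain d1 where d1: "d1 > 0" "\<And>z. cmod (z - a) < d1 \<Longrightarrow> cmod (\<kappa> z - \<kappa> a) < \<eta>"
    using \<eta> unfolding continuous_at_eps_delta dist_norm by metis
  obtain d2 where d2: "d2 > 0" "ball a d2 \<subseteq> ?S"
    using oS aS open_contains_ball by blast
  define U where "U = ball a (min d1 d2)"
  have US: "U \<subseteq> ?S" using d2 by (auto simp: U_def)
  have "open (?m ` U)"
    by (rule open_mapping_thm3[OF holomorphic_on_subset[OF mh US] _ inj_on_subset[OF inj US]]) (simp add: U_def)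
  moreover have "0 \<in> ?m ` U"
    using d1 d2 by (intro image_eqI[of _ _ a]) (auto simp: mob_def U_def)
  ultimately obtain e where e: "e > 0" "ball 0 e \<subseteq> ?m ` U"
    using open_contains_ball by blast
  show ?thesis
  proof (intro exI[of _ e] conjI ballI allI impI)
    fix z \<epsilon> assume z: "z \<in> ?S" and \<epsilon>: "\<epsilon> < e" and lt: "cmod (?m z) < \<epsilon>"
    have "?m z \<in> ball 0 e" using \<epsilon> lt by simp
    then obtain y where y: "y \<in> U" "?m z = ?m y" using e(2) by blast
    then have "z = y" using inj z US unfolding inj_on_def by blast
    then have "cmod (z - a) < d1" using y by (simp add: U_def dist_norm norm_minus_commute)
    then have "cmod (\<kappa> z - \<kappa> a) < \<eta>" by (rule d1)
    then have "Re (\<kappa> a) - \<eta> < Re (\<kappa> z)" using abs_Re_le_cmod[of "\<kappa> z - \<kappa> a"] by (simp add: abs_le_iff)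
    then have ex: "exp (- Re (\<kappa> z)) < exp (\<eta> - Re (\<kappa> a))" by simp
    have "cmod (mob a z) = cmod (?m z) * exp (- Re (\<kappa> z))" by (simp add: norm_mult exp_minus)
    also have "\<dots> \<le> cmod (?m z) * exp (\<eta> - Re (\<kappa> a))" using ex by (intro mult_left_mono) auto
    also have "\<dots> < \<epsilon> * exp (\<eta> - Re (\<kappa> a))" using lt by simp
    finally show "cmod (mob a z) < \<epsilon> * exp (\<eta> - Re (\<kappa> a))" .
  qed (rule e)
qed

lemma indicator_mob_annulus_tendsto:
  assumes "z \<noteq> a" "z \<noteq> - a"
  shows "(\<lambda>n. indicator (mob_annulus a (1 / real (n + 2))) z :: real) \<longlonglongrightarrow> indicator (ball 0 1) z"
proof -
  have pos: "cmod (mob a z) > 0" using mob_nonzero[OF a assms] by simp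
  have "(\<lambda>n. 1 / real (n + 2)) \<longlonglongrightarrow> 0" by real_asymp
  then have "eventually (\<lambda>n. 1 / real (n + 2) < cmod (mob a z)) sequentially"
    using pos by (rule order_tendstoD)
  moreover have "eventually (\<lambda>n. real (n + 2) > cmod (mob a z)) sequentially" by real_asymp
  ultimately have "eventually (\<lambda>n. indicator (mob_annulus a (1 / real (n + 2))) z = (indicator (ball 0 1) z :: real)) sequentially"
    by eventually_elim (auto simp: mob_annulus_def indicator_def)
  then show ?thesis by (rule tendsto_eventually)
qed

text \<open>The balance for a truncation at level \<open>\<delta>\<close>: univalence gives at most
  \<open>4 * pi * (ln (1 / \<delta>) + \<eta> - Re Y)\<close>; the part from \<open>t\<close> alone
  is at least \<open>4 * pi * ln (1 / \<delta>) - 2 * pi * \<Lambda>\<close>; and the rest has a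
  lower bound tending to \<open>- 4 * pi * Re Y + 4 * pi * cmod Y - 2 * pi * \<Lambda>\<close>. The
  terms in \<open>\<delta>\<close> and in \<open>Re Y\<close> cancel, leaving
  \<open>cmod Y \<le> \<Lambda> + \<eta>\<close>.\<close>

lemma grunsky_log_bound:
  assumes R: "R > 1" and kh: "\<kappa> holomorphic_on ball 0 R"
    and odd: "\<And>z. z \<in> ball 0 1 \<Longrightarrow> \<kappa> (- z) = - \<kappa> z"
    and inj: "inj_on (\<lambda>z. mob a z * exp (\<kappa> z)) (ball 0 1 - {- a})"
  shows "cmod (\<kappa> a) \<le> ln ((1 + (cmod a)\<^sup>2) / (1 - (cmod a)\<^sup>2))"
proof -
  define \<Lambda> where "\<Lambda> = ln ((1 + (cmod a)\<^sup>2) / (1 - (cmod a)\<^sup>2))"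
  define Y where "Y = \<kappa> a"
  \<comment> \<open>Since \<open>sgn 0 = 0\<close>, the case \<open>Y = 0\<close> takes a separate
    value to keep \<open>c\<close> unimodular.\<close>
  define c where "c = (if Y = 0 then 1 else sgn Y)"
  have c1: "cmod c = 1" by (simp add: c_def norm_sgn)
  have cY: "Re (cnj c * Y) = cmod Y"
  proof (cases "Y = 0")
    case False
    have "cnj c * Y = of_real (cmod Y)"
      using False complex_norm_square[of Y] by (simp add: c_def sgn_eq field_simps power2_eq_square)
    then show ?thesis by simp
  qed simp
  define k where "k = deriv \<kappa>"
  define t where "t = (\<lambda>z. 1 / (z - a) - 1 / (z + a))"
  define s where "s = (\<lambda>z. cnj a / (1 + cnj a * z) + cnj a / (1 - cnj a * z))"
  have kd: "(\<kappa> has_field_derivative k z) (at z)" if "z \<in> ball 0 R" for z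
    unfolding k_def using holomorphic_derivI[OF kh open_ball that] .
  have kh1: "\<kappa> holomorphic_on ball 0 1" using R by (intro holomorphic_on_subset[OF kh]) auto
  have odda: "\<kappa> a - \<kappa> (- a) = 2 * Y" using odd[of a] a by (simp add: Y_def)
  \<comment> \<open>A minorant of \<open>|t + k|^2 - |t|^2\<close>, obtained from
    \<open>|k - c s|^2 \<ge> 0\<close>. It is real-affine in \<open>k\<close>, so its integral is
    known, and unlike \<open>|t|^2\<close> it is integrable over the whole disc.\<close>
  define G where "G = (\<lambda>z. 2 * Re (k z * cnj (t z)) + 2 * Re (cnj c * (k z * cnj (s z))) - (cmod (s z))\<^sup>2)"
  let ?I = "\<lambda>z. indicator (ball 0 1) z :: real"
  note sk = disc_integral_symmetric_kernels[OF R kd a, folded t_def s_def]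
  have tI: "integrable lborel (\<lambda>z. ?I z *\<^sub>R (k z * cnj (t z)))"
    and tL: "(LINT z|lborel. ?I z *\<^sub>R (k z * cnj (t z))) = - pi * (2 * Y)"
    using sk(1,2) odda by (simp_all add: t_def)
  have sI: "integrable lborel (\<lambda>z. ?I z *\<^sub>R (k z * cnj (s z)))"
    and sL: "(LINT z|lborel. ?I z *\<^sub>R (k z * cnj (s z))) = pi * (2 * Y)"
    using sk(3,4) odda by (simp_all add: s_def)
  have nI: "integrable lborel (\<lambda>z. ?I z *\<^sub>R (cmod (s z))\<^sup>2)"
    and nL: "(LINT z|lborel. ?I z *\<^sub>R (cmod (s z))\<^sup>2) = 2 * pi * \<Lambda>"
    using nn_integral_reflected_log_deriv(2,3)[OF a] by (simp_all add: s_def \<Lambda>_def)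
  define W where "W = (\<lambda>z. 2 * (?I z *\<^sub>R (k z * cnj (t z))) + 2 * cnj c * (?I z *\<^sub>R (k z * cnj (s z))))"
  have WI: "integrable lborel W"
    unfolding W_def by (intro Bochner_Integration.integrable_add integrable_mult_right tI sI)
  have WL: "integral\<^sup>L lborel W = 2 * (- pi * (2 * Y)) + 2 * cnj c * (pi * (2 * Y))"
    unfolding W_def by (simp only: Bochner_Integration.integral_add integrable_mult_right integral_mult_right_zero tL sL tI sI)
  have GW: "(\<lambda>z. ?I z *\<^sub>R G z) = (\<lambda>z. Re (W z) - ?I z *\<^sub>R (cmod (s z))\<^sup>2)"
    by (auto simp: fun_eq_iff G_def W_def indicator_def algebra_simps)
  have GI: "integrable lborel (\<lambda>z. ?I z *\<^sub>R G z)"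
    unfolding GW by (intro Bochner_Integration.integrable_diff integrable_Re WI nI)
  have "(LINT z|lborel. ?I z *\<^sub>R G z) = Re (integral\<^sup>L lborel W) - 2 * pi * \<Lambda>"
    unfolding GW by (simp only: Bochner_Integration.integral_diff[OF integrable_Re[OF WI] nI] nL integral_Re[OF WI])
  also have "Re (integral\<^sup>L lborel W) = - 4 * pi * Re Y + 4 * pi * Re (cnj c * Y)"
    unfolding WL by (simp add: algebra_simps)
  finally have GL: "(LINT z|lborel. ?I z *\<^sub>R G z) = - 4 * pi * Re Y + 4 * pi * cmod Y - 2 * pi * \<Lambda>"
    unfolding cY .
  have pw: "(cmod (t z))\<^sup>2 + G z \<le> (cmod (t z + k z))\<^sup>2" for z
  proof -
    have "0 \<le> (cmod (k z - c * s z))\<^sup>2" by simp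
    also have "(cmod (k z - c * s z))\<^sup>2 = (cmod (k z))\<^sup>2 + (cmod (c * s z))\<^sup>2 - 2 * Re (k z * cnj (c * s z))"
      unfolding cmod_power2 by (simp add: power2_eq_square algebra_simps)
    also have "(cmod (c * s z))\<^sup>2 = (cmod (s z))\<^sup>2" by (simp add: norm_mult c1)
    also have "k z * cnj (c * s z) = cnj c * (k z * cnj (s z))" by simp
    finally have 1: "2 * Re (cnj c * (k z * cnj (s z))) - (cmod (s z))\<^sup>2 \<le> (cmod (k z))\<^sup>2" by linarith
    have "(cmod (t z + k z))\<^sup>2 = (cmod (t z))\<^sup>2 + 2 * Re (k z * cnj (t z)) + (cmod (k z))\<^sup>2"
      unfolding cmod_power2 by (simp add: power2_eq_square algebra_simps)
    then show ?thesis using 1 by (simp add: G_def)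
  qed
  let ?m = "\<lambda>z. mob a z * exp (\<kappa> z)"
  let ?S = "ball 0 1 - {a, - a}"
  have "4 * pi * cmod Y \<le> 4 * pi * \<Lambda> + 4 * pi * \<eta>" if \<eta>: "\<eta> > 0" for \<eta>
  proof -
    obtain e where e: "e > 0" "\<And>z \<epsilon>. z \<in> ball 0 1 - {- a} \<Longrightarrow> \<epsilon> < e \<Longrightarrow> cmod (?m z) < \<epsilon> \<Longrightarrow> cmod (mob a z) < \<epsilon> * exp (\<eta> - Re Y)"
      using mob_level_inclusion[OF kh1 inj \<eta>] unfolding Y_def by blast
    define q where "q = exp (\<eta> - Re Y)"
    have q0: "q > 0" by (simp add: q_def)
    have key: "(LINT z|lborel. indicator (mob_annulus a \<delta>) z *\<^sub>R G z) \<le> 4 * pi * (\<eta> - Re Y) + 2 * pi * \<Lambda>"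
      if \<delta>: "0 < \<delta>" "\<delta> < 1" "\<delta> < e * q" "\<delta> < q" for \<delta>
    proof -
      let ?A = "mob_annulus a \<delta>"
      have Ab: "?A \<in> sets borel" using mob_annulus_open[OF a] \<delta> by simp
      note av = mob_annulus_avoids[OF a _ \<delta>(1)]
      \<comment> \<open>With this level, a value of \<open>?m\<close> below
        \<open>\<epsilon>\<close> in modulus would force \<open>mob a\<close> below
        \<open>\<epsilon> * q = \<delta>\<close>; on the truncated disc \<open>?m\<close> therefore
        stays above \<open>\<epsilon>\<close>.\<close>
      define \<epsilon> where "\<epsilon> = \<delta> / q"
      have \<epsilon>: "0 < \<epsilon>" "\<epsilon> < e" "\<epsilon> < 1" "\<epsilon> * q = \<delta>" using \<delta> q0 by (auto simp: \<epsilon>_def field_simps)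
      have lnq: "ln q = \<eta> - Re Y" by (simp add: q_def)
      have lnE: "ln (1 / \<epsilon>) = ln (1 / \<delta>) + (\<eta> - Re Y)"
        using \<delta> q0 by (simp add: \<epsilon>_def ln_div lnq)
      have lower: "\<epsilon> \<le> cmod (?m z)" if "z \<in> ball 0 1" "z \<noteq> - a" "\<delta> < cmod (mob a z)" for z
        using e(2)[of z \<epsilon>] that \<epsilon> unfolding q_def[symmetric] by force
      have mz: "mob a (- z) = 1 / mob a z" if "z \<noteq> a" "z \<noteq> - a" for z
      proof -
        have "z - a \<noteq> 0" "a - z \<noteq> 0" using that by auto
        then show ?thesis by (simp add: mob_def frac_eq_eq) (simp add: algebra_simps)
      qed
      have bd: "\<bar>ln (cmod (?m z))\<bar> \<le> ln (1 / \<epsilon>)" if z: "z \<in> ?A" for z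
      proof -
        have z1: "z \<in> ball 0 1" "\<delta> < cmod (mob a z)" "cmod (mob a z) < 1 / \<delta>" using z by (auto simp: mob_annulus_def)
        have l1: "\<epsilon> \<le> cmod (?m z)" using lower[OF z1(1)] z1 av[OF z] by blast
        have mp: "cmod (mob a z) > 0" using z1 \<delta> by linarith
        \<comment> \<open>The upper bound for \<open>?m\<close> at \<open>z\<close> is the lower
          bound at \<open>- z\<close>: the truncated disc is symmetric, and oddness of
          \<open>\<kappa>\<close> gives \<open>?m (- z) = 1 / ?m z\<close>.\<close>
        have "\<delta> < cmod (mob a (- z))"
          using z1 mp \<delta> by (simp add: mz[OF av(1,2)[OF z]] norm_divide field_simps)
        then have "\<epsilon> \<le> cmod (?m (- z))" using lower[of "- z"] z1 av[OF z] by auto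
        also have "?m (- z) = 1 / ?m z"
          using mz[OF av(1,2)[OF z]] odd[OF z1(1)] by (simp add: exp_minus field_simps)
        finally have l2: "\<epsilon> \<le> 1 / cmod (?m z)" by (simp add: norm_divide)
        have p: "cmod (?m z) > 0" using l1 \<epsilon> by linarith
        have "ln \<epsilon> \<le> ln (cmod (?m z))" using l1 \<epsilon> p by simp
        moreover have "ln \<epsilon> \<le> ln (1 / cmod (?m z))" using l2 \<epsilon> p by (subst ln_le_cancel_iff) auto
        then have "ln \<epsilon> \<le> - ln (cmod (?m z))" using p by (simp only: ln_div ln_one) simp
        ultimately show ?thesis using \<epsilon> by (simp add: ln_div)
      qed
      have ld: "deriv ?m z / ?m z = t z + k z" if "z \<in> ?S" for z
      proof -
        have zz: "z \<noteq> a" "z \<noteq> - a" "z \<in> ball 0 R" using that R by auto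
        have "(?m has_field_derivative (mob a z * (1 / (z - a) - 1 / (z + a)) * exp (\<kappa> z) + exp (\<kappa> z) * k z * mob a z)) (at z)"
          by (rule derivative_eq_intros mob_has_derivative[OF a] kd zz refl)+
        then show ?thesis using mob_nonzero[OF a zz(1,2)]
          by (simp add: DERIV_imp_deriv t_def field_simps)
      qed
      have "(\<integral>\<^sup>+z. ennreal ((cmod (deriv ?m z / ?m z))\<^sup>2) * indicator ?A z \<partial>lborel) \<le> ennreal (4 * pi * ln (1 / \<epsilon>))"
      proof (rule nn_integral_log_deriv_le)
        show "open ?S" by (intro open_Diff) auto
        show "?m holomorphic_on ?S"
          by (intro holomorphic_intros holomorphic_on_subset[OF mob_holomorphic[OF a]] holomorphic_on_subset[OF kh1]) auto
        show "inj_on ?m ?S" by (rule inj_on_subset[OF inj]) auto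
        show "?A \<subseteq> ?S" using av by auto
        show "ln (1 / \<epsilon>) \<ge> 0" using \<epsilon> by simp
      qed (use mob_nonzero[OF a] Ab bd in auto)
      moreover have "(\<integral>\<^sup>+z. ennreal ((cmod (deriv ?m z / ?m z))\<^sup>2) * indicator ?A z \<partial>lborel) 
         = (\<integral>\<^sup>+z. ennreal ((cmod (t z + k z))\<^sup>2) * indicator ?A z \<partial>lborel)"
        using ld av by (intro nn_integral_cong) (auto simp: indicator_def)
      ultimately have up: "(\<integral>\<^sup>+z. ennreal ((cmod (t z + k z))\<^sup>2) * indicator ?A z \<partial>lborel) \<le> ennreal (4 * pi * ln (1 / \<epsilon>))"
        by simp
      have contt: "continuous_on ?A t" unfolding t_def
        by (intro continuous_intros) (use av in \<open>auto simp: add_eq_0_iff2\<close>)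
      have tm: "(\<lambda>z. indicator ?A z *\<^sub>R (cmod (t z))\<^sup>2) \<in> borel_measurable borel"
        using Ab contt by (intro borel_measurable_continuous_on_indicator continuous_intros) auto
      have eqn: "(\<integral>\<^sup>+z. ennreal (indicator ?A z *\<^sub>R (cmod (t z))\<^sup>2) \<partial>lborel) = (\<integral>\<^sup>+z. ennreal ((cmod (t z))\<^sup>2) * indicator ?A z \<partial>lborel)"
        by (intro nn_integral_cong) (simp add: indicator_def)
      have tAI: "integrable lborel (\<lambda>z. indicator ?A z *\<^sub>R (cmod (t z))\<^sup>2)"
      proof (rule integrableI_nonneg)
        have "(\<integral>\<^sup>+z. ennreal (indicator ?A z *\<^sub>R (cmod (t z))\<^sup>2) \<partial>lborel) \<le> ennreal (4 * pi * ln (1 / \<delta>))"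
          unfolding eqn using nn_integral_mob_annulus_le[OF a \<delta>(1,2)] by (simp add: t_def)
        then show "(\<integral>\<^sup>+z. ennreal (indicator ?A z *\<^sub>R (cmod (t z))\<^sup>2) \<partial>lborel) < \<infinity>"
          using le_less_trans ennreal_less_top by fastforce
      qed (use tm in auto)
      define X where "X = (LINT z|lborel. indicator ?A z *\<^sub>R (cmod (t z))\<^sup>2)"
      have X0: "X \<ge> 0" unfolding X_def by (rule Bochner_Integration.integral_nonneg) simp
      have "(\<integral>\<^sup>+z. ennreal ((cmod (t z))\<^sup>2) * indicator ?A z \<partial>lborel) = ennreal X"
        unfolding eqn[symmetric] X_def by (rule nn_integral_eq_integral[OF tAI]) auto
      then have "ennreal (4 * pi * ln (1 / \<delta>)) \<le> ennreal X + ennreal (2 * pi * \<Lambda>)"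
        using nn_integral_mob_annulus_ge[OF a \<delta>(1,2)] by (simp add: t_def \<Lambda>_def)
      moreover have L0: "\<Lambda> \<ge> 0"
        using nL by (smt (verit) Bochner_Integration.integral_nonneg indicator_pos_le mult_pos_neg pi_gt_zero scaleR_nonneg_nonneg zero_le_power2)
      ultimately have Xl: "4 * pi * ln (1 / \<delta>) \<le> X + 2 * pi * \<Lambda>"
        using X0 by (simp add: ennreal_plus[symmetric] ennreal_le_iff del: ennreal_plus)
      have GA: "integrable lborel (\<lambda>z. indicator ?A z *\<^sub>R G z)"
      proof -
        have "integrable lborel (\<lambda>z. indicator ?A z *\<^sub>R (?I z *\<^sub>R G z))"
          using Ab by (intro integrable_mult_indicator GI) simp
        also have "(\<lambda>z. indicator ?A z *\<^sub>R (?I z *\<^sub>R G z)) = (\<lambda>z. indicator ?A z *\<^sub>R G z)"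
          using av by (auto simp: fun_eq_iff indicator_def)
        finally show ?thesis .
      qed
      have "X + (LINT z|lborel. indicator ?A z *\<^sub>R G z) = (LINT z|lborel. indicator ?A z *\<^sub>R (cmod (t z))\<^sup>2 + indicator ?A z *\<^sub>R G z)"
        unfolding X_def by (rule Bochner_Integration.integral_add[OF tAI GA, symmetric])
      also have "\<dots> \<le> 4 * pi * ln (1 / \<epsilon>)"
      proof (rule integral_real_bounded)
        show "0 \<le> 4 * pi * ln (1 / \<epsilon>)" using \<epsilon> by simp
        have "(\<integral>\<^sup>+z. ennreal (indicator ?A z *\<^sub>R (cmod (t z))\<^sup>2 + indicator ?A z *\<^sub>R G z) \<partial>lborel) \<le> (\<integral>\<^sup>+z. ennreal ((cmod (t z + k z))\<^sup>2) * indicator ?A z \<partial>lborel)"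
          using pw by (intro nn_integral_mono) (auto simp: indicator_def intro!: ennreal_leI)
        then show "(\<integral>\<^sup>+z. ennreal (indicator ?A z *\<^sub>R (cmod (t z))\<^sup>2 + indicator ?A z *\<^sub>R G z) \<partial>lborel) \<le> ennreal (4 * pi * ln (1 / \<epsilon>))"
          using up by (rule order_trans)
      qed
      finally show ?thesis using Xl unfolding lnE by (simp add: algebra_simps)
    qed
    \<comment> \<open>Since \<open>key\<close> no longer contains \<open>\<delta>\<close> on the
      right nor \<open>|t|^2\<close> on the left, dominated convergence applies to \<open>G\<close>
      alone.\<close>
    have lim: "(\<lambda>n. LINT z|lborel. indicator (mob_annulus a (1 / real (n + 2))) z *\<^sub>R G z) \<longlonglongrightarrow> (LINT z|lborel. ?I z *\<^sub>R G z)"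
    proof (rule integral_dominated_convergence[where w="\<lambda>z. norm (?I z *\<^sub>R G z)"])
      show "(\<lambda>z. ?I z *\<^sub>R G z) \<in> borel_measurable lborel" using GI by (rule borel_measurable_integrable)
      show "integrable lborel (\<lambda>z. norm (?I z *\<^sub>R G z))" using GI by (rule integrable_norm)
      have eqA: "(\<lambda>z. indicator (mob_annulus a (1 / real (n + 2))) z *\<^sub>R G z) = (\<lambda>z. indicator (mob_annulus a (1 / real (n + 2))) z *\<^sub>R (?I z *\<^sub>R G z))" for n
        by (auto simp: fun_eq_iff indicator_def mob_annulus_def)
      show "(\<lambda>z. indicator (mob_annulus a (1 / real (n + 2))) z *\<^sub>R G z) \<in> borel_measurable lborel" for n
        unfolding eqA using mob_annulus_open[OF a, of "1 / real (n + 2)"]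
        by (intro borel_measurable_integrable[OF integrable_mult_indicator[OF _ GI]]) auto
      show "AE z in lborel. (\<lambda>n. indicator (mob_annulus a (1 / real (n + 2))) z *\<^sub>R G z) \<longlonglongrightarrow> ?I z *\<^sub>R G z"
        using AE_lborel_singleton[of a] AE_lborel_singleton[of "- a"]
        by eventually_elim (intro tendsto_intros indicator_mob_annulus_tendsto, auto)
      show "AE z in lborel. norm (indicator (mob_annulus a (1 / real (n + 2))) z *\<^sub>R G z) \<le> norm (?I z *\<^sub>R G z)" for n
        by (auto simp: indicator_def mob_annulus_def)
    qed
    have "(\<lambda>n. 1 / real (n + 2)) \<longlonglongrightarrow> 0" by real_asymp
    moreover have "0 < min (min 1 (e * q)) q" using e q0 by simp
    ultimately have "eventually (\<lambda>n. 1 / real (n + 2) < min (min 1 (e * q)) q) sequentially"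
      by (rule order_tendstoD)
    then have "eventually (\<lambda>n. (LINT z|lborel. indicator (mob_annulus a (1 / real (n + 2))) z *\<^sub>R G z) \<le> 4 * pi * (\<eta> - Re Y) + 2 * pi * \<Lambda>) sequentially"
      by eventually_elim (rule key, auto)
    then have "(LINT z|lborel. ?I z *\<^sub>R G z) \<le> 4 * pi * (\<eta> - Re Y) + 2 * pi * \<Lambda>"
      by (rule tendsto_upperbound[OF lim]) simp
    then show ?thesis unfolding GL by (simp add: algebra_simps)
  qed
  then have "cmod Y \<le> \<Lambda> + \<eta>" if "\<eta> > 0" for \<eta>
  proof -
    have "(4 * pi) * cmod Y \<le> (4 * pi) * (\<Lambda> + \<eta>)"
      using \<open>\<And>\<eta>. \<eta> > 0 \<Longrightarrow> 4 * pi * cmod Y \<le> 4 * pi * \<Lambda> + 4 * pi * \<eta>\<close>[OF that] by (simp add: algebra_simps)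
    then show ?thesis by simp
  qed
  then have "cmod Y \<le> \<Lambda>" by (rule field_le_epsilon)
  then show ?thesis by (simp add: Y_def \<Lambda>_def)
qed

end

section \<open>The logarithmic derivative of a univalent function\<close>

text \<open>The power series of \<open>exp z - 1\<close> has positive coefficients. The estimate
  converts a bound for the logarithm of \<open>z f'/f\<close> into one for \<open>z f'/f - 1\<close>
  without loss when the logarithm is positive.\<close>

lemma cmod_exp_minus_one_le: "cmod (exp z - 1) \<le> exp (cmod z) - 1"
proof -
  have s: "summable (\<lambda>n. inverse (fact (Suc n)) *\<^sub>R (cmod z) ^ Suc n)"
    using summable_exp_generic[of "cmod z"] summable_Suc_iff[of "\<lambda>n. (cmod z) ^ n /\<^sub>R fact n"] by simp
  have "exp z - 1 = (\<Sum>n. inverse (fact (Suc n)) *\<^sub>R z ^ Suc n)"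
    using exp_first_term[of z] by simp
  also have "cmod \<dots> \<le> (\<Sum>n. cmod (inverse (fact (Suc n)) *\<^sub>R z ^ Suc n))"
    using s by (intro summable_norm) (simp add: norm_power norm_mult)
  also have "\<dots> = (\<Sum>n. inverse (fact (Suc n)) *\<^sub>R (cmod z) ^ Suc n)"
    by (simp add: norm_power norm_mult)
  also have "\<dots> = exp (cmod z) - 1"
    using exp_first_term[of "cmod z"] by simp
  finally show ?thesis .
qed

text \<open>Off \<open>p\<close> injectivity excludes a zero, at \<open>p\<close> the nonvanishing
  derivative does. On a disc this provides holomorphic logarithms of difference quotients.\<close>

lemma inj_on_divided_difference_nonzero:
  assumes S: "open S" and f: "f holomorphic_on S" and inj: "inj_on f S" and p: "p \<in> S" and z: "z \<in> S"
  shows "(if z = p then deriv f p else (f z - f p) / (z - p)) \<noteq> 0"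
  using holomorphic_injective_imp_regular[OF f S inj p] inj p z by (auto simp: inj_on_def)

lemma log_deriv_bound_on_larger_disc:
  assumes R: "R > 1" and g: "g holomorphic_on ball 0 R" and inj: "inj_on g (ball 0 R)" and g0: "g 0 = 0"
    and p: "p \<noteq> 0" "cmod p < 1"
  shows "cmod (p * deriv g p / g p - 1) \<le> 2 * cmod p / (1 - cmod p)"
proof -
  define \<phi> where "\<phi> = (\<lambda>z. if z = 0 then deriv g 0 else (g z - g 0) / (z - 0))"
  have \<phi>h: "\<phi> holomorphic_on ball 0 R" unfolding \<phi>_def by (intro pole_lemma_open g) auto
  have \<phi>0: "\<phi> z \<noteq> 0" if "z \<in> ball 0 R" for z
    unfolding \<phi>_def using inj_on_divided_difference_nonzero[OF open_ball g inj _ that, of 0] R by simp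
  have "0 \<in> ball (0::complex) R" using R by simp
  from holomorphic_logarithm_exists[OF convex_ball open_ball \<phi>h \<phi>0 this]
  obtain l where l: "l holomorphic_on ball 0 R" "\<And>z. z \<in> ball 0 R \<Longrightarrow> exp (l z) = \<phi> z"
    by blast
  have gl: "g z = z * exp (l z)" if "z \<in> ball 0 R" for z
    using l(2)[OF that] g0 by (simp add: \<phi>_def)
  define Q where "Q = sqrt R"
  have Q: "Q > 1" "Q\<^sup>2 = R" using R by (auto simp: Q_def)
  have sq: "z\<^sup>2 \<in> ball 0 R" if "z \<in> ball 0 Q" for z :: complex
  proof -
    have "(cmod z)\<^sup>2 < Q\<^sup>2" using that by (intro power_strict_mono) auto
    then show ?thesis using Q by (simp add: norm_power)
  qed
  \<comment> \<open>The root transform: halving a logarithm of \<open>g z / z\<close> avoids any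
    choice of branch. Equality of squares leaves \<open>x = - y\<close> as the only danger to
    injectivity, and there oddness gives \<open>h y = 0\<close>.\<close>
  define h where "h = (\<lambda>z. z * exp (l (z\<^sup>2) / 2))"
  have hh: "h holomorphic_on ball 0 Q"
    unfolding h_def
    by (intro holomorphic_intros holomorphic_on_compose_gen[OF _ l(1), unfolded o_def]) (use sq in auto)
  have hodd: "h (- z) = - h z" for z by (simp add: h_def)
  have hsq: "(h z)\<^sup>2 = g (z\<^sup>2)" if "z \<in> ball 0 Q" for z
    using gl[OF sq[OF that]] by (simp add: h_def power_mult_distrib exp_double[symmetric])
  have h0: "h z = 0 \<longleftrightarrow> z = 0" for z by (simp add: h_def)
  have hinj: "inj_on h (ball 0 Q)"
  proof (rule inj_onI)
    fix x y assume x: "x \<in> ball 0 Q" and y: "y \<in> ball 0 Q" and eq: "h x = h y"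
    have "g (x\<^sup>2) = g (y\<^sup>2)" using hsq[OF x] hsq[OF y] eq by simp
    then have "x\<^sup>2 = y\<^sup>2" using inj sq[OF x] sq[OF y] by (auto simp: inj_on_def)
    then have "x = y \<or> x = - y" by (simp add: power2_eq_iff)
    then show "x = y"
    proof
      assume "x = - y"
      then have "h y = 0" using eq hodd[of y] by simp
      then show "x = y" using \<open>x = - y\<close> h0 by simp
    qed
  qed
  define a where "a = csqrt p"
  have a2: "a\<^sup>2 = p" by (simp add: a_def)
  have a0: "a \<noteq> 0" using a2 p by auto
  have ca: "(cmod a)\<^sup>2 = cmod p" using a2 by (metis norm_power)
  have a1: "cmod a < 1" using ca p by (metis norm_ge_zero not_le one_le_power)
  have aQ: "a \<in> ball 0 Q" "- a \<in> ball 0 Q" using a1 Q by auto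
  define D where "D = (\<lambda>z. if z = a then deriv h a else (h z - h a) / (z - a))"
  have Dh: "D holomorphic_on ball 0 Q" unfolding D_def by (intro pole_lemma_open hh) auto
  have Dn: "D z \<noteq> 0" if "z \<in> ball 0 Q" for z
    unfolding D_def using inj_on_divided_difference_nonzero[OF open_ball hh hinj aQ(1) that] .
  obtain d where d: "d holomorphic_on ball 0 Q" "\<And>z. z \<in> ball 0 Q \<Longrightarrow> exp (d z) = D z"
    using holomorphic_logarithm_exists[OF convex_ball open_ball Dh Dn aQ(1)] by blast
  \<comment> \<open>As \<open>h\<close> is odd, \<open>h z + h a\<close> equals
    \<open>(z + a) * D (- z)\<close>, so the quotient to be studied is
    \<open>mob a z * D z / D (- z)\<close>; antisymmetrising the logarithm of \<open>D\<close> gives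
    \<open>\<kappa>\<close>, which is odd by construction.\<close>
  define \<kappa> where "\<kappa> = (\<lambda>z. d z - d (- z))"
  have \<kappa>h: "\<kappa> holomorphic_on ball 0 Q"
    unfolding \<kappa>_def
    by (intro holomorphic_intros d(1) holomorphic_on_compose_gen[OF _ d(1), unfolded o_def]) auto
  have ek: "exp (\<kappa> z) = D z / D (- z)" if "z \<in> ball 0 Q" for z
    using d(2)[of z] d(2)[of "- z"] that by (simp add: \<kappa>_def exp_diff)
  have hpm: "h z + h a \<noteq> 0" if "z \<in> ball 0 Q" "z \<noteq> - a" for z
  proof
    assume "h z + h a = 0"
    then have "h z = h (- a)" by (simp add: hodd add_eq_0_iff2)
    then show False using hinj that aQ unfolding inj_on_def by blast
  qed
  have m: "mob a z * exp (\<kappa> z) = (h z - h a) / (h z + h a)" if z: "z \<in> ball 0 Q" "z \<noteq> - a" for z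
  proof (cases "z = a")
    case True then show ?thesis by (simp add: mob_def)
  next
    case False
    have za: "z - a \<noteq> 0" "z + a \<noteq> 0" using False z by (auto simp: add_eq_0_iff2)
    have "D (- z) = (- h z - h a) / (- z - a)" using z by (auto simp: D_def hodd)
    moreover have "- h z - h a = - (h z + h a)" "- z - a = - (z + a)" by simp_all
    ultimately have "D (- z) = (h z + h a) / (z + a)" by (simp only: minus_divide_divide)
    moreover have "D z = (h z - h a) / (z - a)" using False by (simp add: D_def)
    ultimately show ?thesis using za hpm[OF z] by (simp add: ek[OF z(1)] mob_def)
  qed
  have minj: "inj_on (\<lambda>z. mob a z * exp (\<kappa> z)) (ball 0 1 - {- a})"
  proof (rule inj_onI)
    fix x y assume xy: "x \<in> ball 0 1 - {- a}" "y \<in> ball 0 1 - {- a}" "mob a x * exp (\<kappa> x) = mob a y * exp (\<kappa> y)"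
    then have b: "x \<in> ball 0 Q" "x \<noteq> - a" "y \<in> ball 0 Q" "y \<noteq> - a" using Q by auto
    have "(h x - h a) / (h x + h a) = (h y - h a) / (h y + h a)"
      using xy(3) m[OF b(1,2)] m[OF b(3,4)] by simp
    then have "(h x - h a) * (h y + h a) = (h y - h a) * (h x + h a)"
      using hpm[OF b(1,2)] hpm[OF b(3,4)] by (simp add: frac_eq_eq)
    then have "2 * h a * h x = 2 * h a * h y" by (simp add: algebra_simps)
    then have "h x = h y" using h0[of a] a0 by simp
    then show "x = y" using hinj b unfolding inj_on_def by blast
  qed
  have bound: "cmod (\<kappa> a) \<le> ln ((1 + cmod p) / (1 - cmod p))"
    using grunsky_log_bound[OF a0 a1 Q(1) \<kappa>h _ minj] by (simp add: ca \<kappa>_def)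
  \<comment> \<open>Here \<open>D a / D (- a) = a * deriv h a / h a\<close>, and logarithmic
    differentiation of \<open>(h z)^2 = g (z^2)\<close> at \<open>a\<close> turns this into the
    quotient at \<open>p = a^2\<close>. Both sides are computed as
    \<open>1 + p * deriv l p\<close>.\<close>
  have w: "exp (\<kappa> a) = p * deriv g p / g p"
  proof -
    have pR: "p \<in> ball 0 R" using p R by simp
    have ld: "(l has_field_derivative deriv l p) (at p)" using holomorphic_derivI[OF l(1) open_ball pR] .
    have "((\<lambda>z. z * exp (l z)) has_field_derivative (exp (l p) + p * (exp (l p) * deriv l p))) (at p)"
      using ld by (auto intro!: derivative_eq_intros)
    then have "(g has_field_derivative (exp (l p) + p * (exp (l p) * deriv l p))) (at p)"
      by (rule has_field_derivative_transform_within_open[where S="ball 0 R"]) (use pR gl in auto)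
    then have "p * deriv g p / g p = 1 + p * deriv l p"
      using p(1) gl[OF pR] by (simp add: DERIV_imp_deriv field_simps)
    have ld2: "((\<lambda>z. l (z\<^sup>2)) has_field_derivative (deriv l p * (2 * a))) (at a)"
    proof (rule DERIV_chain2[where f=l and g="\<lambda>z. z\<^sup>2"])
      show "(l has_field_derivative deriv l p) (at (a\<^sup>2))" using ld by (simp add: a2)
    qed (auto intro!: derivative_eq_intros)
    have "(h has_field_derivative (exp (l p / 2) + a * (exp (l p / 2) * (deriv l p * (2 * a) / 2)))) (at a)"
      unfolding h_def by (rule derivative_eq_intros ld2 refl | simp add: a2)+
    then have dh: "deriv h a = exp (l p / 2) * (1 + p * deriv l p)"
      by (simp add: DERIV_imp_deriv a2[symmetric] power2_eq_square algebra_simps)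
    have "exp (\<kappa> a) = deriv h a / ((- h a - h a) / (- a - a))"
      using ek[OF aQ(1)] a0 by (simp add: D_def hodd)
    also have "(- h a - h a) / (- a - a) = exp (l p / 2)"
      using a0 by (simp add: h_def a2 field_simps)
    finally have "exp (\<kappa> a) = 1 + p * deriv l p" by (simp add: dh)
    with \<open>p * deriv g p / g p = 1 + p * deriv l p\<close> show ?thesis by simp
  qed
  have "cmod (exp (\<kappa> a) - 1) \<le> exp (cmod (\<kappa> a)) - 1" by (rule cmod_exp_minus_one_le)
  also have "\<dots> \<le> exp (ln ((1 + cmod p) / (1 - cmod p))) - 1" using bound by simp
  also have "\<dots> = (1 + cmod p) / (1 - cmod p) - 1"
    using p by (subst exp_ln) (auto intro!: divide_pos_pos add_pos_nonneg)
  also have "\<dots> = 2 * cmod p / (1 - cmod p)" using p by (simp add: field_simps)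
  finally show ?thesis unfolding w .
qed

text \<open>The dilation \<open>f (\<rho> z)\<close> is univalent on the disc of radius
  \<open>1 / \<rho> > 1\<close>, and its quotient at \<open>p / \<rho>\<close> is that of
  \<open>f\<close> at \<open>p\<close>. The bound obtained there is
  \<open>2 * cmod p / (\<rho> - cmod p)\<close>, and \<open>\<rho>\<close> tends to 1.\<close>

lemma log_deriv_bound_univalent:
  assumes f: "f holomorphic_on ball 0 1" and inj: "inj_on f (ball 0 1)" and f0: "f 0 = 0"
    and p: "p \<noteq> 0" "cmod p < 1"
  shows "cmod (p * deriv f p / f p - 1) \<le> 2 * cmod p / (1 - cmod p)"
proof (rule tendsto_lowerbound)
  show "((\<lambda>\<rho>. 2 * cmod p / (\<rho> - cmod p)) \<longlongrightarrow> 2 * cmod p / (1 - cmod p)) (at_left 1)"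
    using p by (intro tendsto_intros) auto
  have "eventually (\<lambda>\<rho>. \<rho> \<in> {cmod p<..<1}) (at_left 1)"
    using p eventually_at_left_real by blast
  then show "eventually (\<lambda>\<rho>. cmod (p * deriv f p / f p - 1) \<le> 2 * cmod p / (\<rho> - cmod p)) (at_left 1)"
  proof eventually_elim
    case (elim \<rho>)
    then have \<rho>: "cmod p < \<rho>" "\<rho> < 1" "0 < \<rho>" using p by (auto intro: le_less_trans[OF norm_ge_zero])
    let ?g = "\<lambda>z. f (of_real \<rho> * z)"
    have sub: "of_real \<rho> * z \<in> ball 0 1" if "z \<in> ball 0 (1 / \<rho>)" for z :: complex
      using that \<rho> by (simp add: norm_mult field_simps)
    have "?g holomorphic_on ball 0 (1 / \<rho>)"
      by (intro holomorphic_on_compose_gen[OF _ f, unfolded o_def] holomorphic_intros) (use sub in auto)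
    moreover have "inj_on ?g (ball 0 (1 / \<rho>))"
    proof (rule inj_onI)
      fix x y assume "x \<in> ball 0 (1 / \<rho>)" "y \<in> ball 0 (1 / \<rho>)" "?g x = ?g y"
      then have "of_real \<rho> * x = of_real \<rho> * y" using sub inj unfolding inj_on_def by blast
      then show "x = y" using \<rho> by simp
    qed
    ultimately have b: "cmod (p / \<rho> * deriv ?g (p / \<rho>) / ?g (p / \<rho>) - 1) \<le> 2 * cmod (p / \<rho>) / (1 - cmod (p / \<rho>))"
      using p \<rho> f0 by (intro log_deriv_bound_on_larger_disc) (auto simp: norm_divide)
    have "(f has_field_derivative deriv f p) (at p)"
      using p by (intro holomorphic_derivI[OF f]) auto
    then have "(?g has_field_derivative (deriv f p * of_real \<rho>)) (at (p / \<rho>))"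
      using \<rho> by (intro DERIV_chain2[where f=f]) (auto intro!: derivative_eq_intros)
    then have "deriv ?g (p / \<rho>) = deriv f p * of_real \<rho>" by (rule DERIV_imp_deriv)
    with b have "cmod (p * deriv f p / f p - 1) \<le> 2 * (cmod p / \<rho>) / (1 - cmod p / \<rho>)"
      using \<rho> by (simp add: norm_divide)
    also have "\<dots> = 2 * cmod p / (\<rho> - cmod p)" using \<rho> by (simp add: field_simps)
    finally show ?case .
  qed
qed auto

section \<open>The pre-Schwarzian norm\<close>

text \<open>The removable singularity at the origin has to be filled in by hand, as \<open>f 0 / 0 = 0\<close>.\<close>
definition C_integrand :: "real \<Rightarrow> (complex \<Rightarrow> complex) \<Rightarrow> complex \<Rightarrow> complex" where
  "C_integrand \<beta> f z = (if z = 0 then deriv f 0 else f z / z) / (1 - z) powr (of_real \<beta>)"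

lemma one_minus_not_nonpos: "z \<in> unit_disk \<Longrightarrow> 1 - z \<notin> \<real>\<^sub>\<le>\<^sub>0"
  using abs_Re_le_cmod[of z] by (auto simp: unit_disk_def complex_nonpos_Reals_iff abs_le_iff)

lemma C_integrand_holomorphic:
  assumes f: "f holomorphic_on unit_disk" "f 0 = 0"
  shows "C_integrand \<beta> f holomorphic_on unit_disk"
proof -
  have "(\<lambda>z. if z = 0 then deriv f 0 else (f z - f 0) / (z - 0)) holomorphic_on unit_disk"
    by (rule pole_lemma_open[OF f(1)]) (simp add: unit_disk_def)
  then have "(\<lambda>z. if z = 0 then deriv f 0 else f z / z) holomorphic_on unit_disk"
    by (rule holomorphic_transform) (simp add: f(2))
  moreover have "(1 - z) powr (of_real \<beta>) \<noteq> 0" if "z \<in> unit_disk" for z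
    using one_minus_not_nonpos[OF that] by auto
  ultimately show ?thesis
    unfolding C_integrand_def[abs_def] using one_minus_not_nonpos
    by (intro holomorphic_on_divide holomorphic_intros) auto
qed

lemma C_op_has_derivative:
  assumes f: "f holomorphic_on unit_disk" "f 0 = 0" and z: "z \<in> unit_disk"
  shows "(C_op \<beta> f has_field_derivative C_integrand \<beta> f z) (at z)"
proof -
  have cv: "convex unit_disk" "open unit_disk" by (auto simp: unit_disk_def)
  obtain H where H: "\<And>x. x \<in> unit_disk \<Longrightarrow> (H has_field_derivative C_integrand \<beta> f x) (at x within unit_disk)"
    using holomorphic_convex_primitive'[OF cv C_integrand_holomorphic[OF f]] by blast
  have C: "C_op \<beta> f w = H w - H 0" if w: "w \<in> unit_disk" for w
  proof (cases "w = 0")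
    case False
    have "closed_segment 0 w \<subseteq> unit_disk"
      using w cv by (intro closed_segment_subset) (auto simp: unit_disk_def)
    then have "(C_integrand \<beta> f has_contour_integral (H w - H 0)) (linepath 0 w)"
      using contour_integral_primitive[OF H, of "linepath 0 w"] by simp
    then have "((\<lambda>x. C_integrand \<beta> f (linepath 0 w x) * (w - 0)) has_integral (H w - H 0)) {0..1}"
      by (simp add: has_contour_integral_linepath)
    then have "((\<lambda>x. (\<lambda>w. f w / (w * (1 - w) powr of_real \<beta>)) (linepath 0 w x) * (w - 0)) has_integral (H w - H 0)) {0..1}"
    \<comment> \<open>The integrand of \<open>C_op\<close> takes the value 0 at the origin by the
      convention for division. For \<open>w \<noteq> 0\<close> the segment meets the origin only at
      parameter 0; the degenerate segment is the other case.\<close>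
    proof (rule has_integral_spike_finite[where S="{0}", rotated 2])
      fix x :: real assume "x \<in> {0..1} - {0}"
      then have "linepath 0 w x \<noteq> 0" using False by (simp add: linepath_def)
      then show "(\<lambda>w. f w / (w * (1 - w) powr of_real \<beta>)) (linepath 0 w x) * (w - 0) = C_integrand \<beta> f (linepath 0 w x) * (w - 0)"
        by (simp add: C_integrand_def)
    qed simp
    then have "((\<lambda>w. f w / (w * (1 - w) powr of_real \<beta>)) has_contour_integral (H w - H 0)) (linepath 0 w)"
      by (simp add: has_contour_integral_linepath)
    then show ?thesis unfolding C_op_def by (rule contour_integral_unique)
  qed (simp add: C_op_def)
  have "((\<lambda>w. H w - H 0) has_field_derivative C_integrand \<beta> f z) (at z)"
    using H[OF z] cv z at_within_open[OF z cv(2)] by (auto intro!: derivative_eq_intros)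
  then show ?thesis
    by (rule has_field_derivative_transform_within_open[OF _ cv(2) z]) (simp add: C)
qed

lemma C_op_derivs:
  assumes f: "f holomorphic_on unit_disk" "f 0 = 0" and z: "z \<in> unit_disk"
  shows "deriv (C_op \<beta> f) z = C_integrand \<beta> f z" "deriv (deriv (C_op \<beta> f)) z = deriv (C_integrand \<beta> f) z"
proof -
  have d: "deriv (C_op \<beta> f) w = C_integrand \<beta> f w" if "w \<in> unit_disk" for w
    using C_op_has_derivative[OF f that] by (rule DERIV_imp_deriv)
  then show "deriv (C_op \<beta> f) z = C_integrand \<beta> f z" using z by blast
  have "open unit_disk" by (simp add: unit_disk_def)
  then have "eventually (\<lambda>w. w \<in> unit_disk) (nhds z)" using z eventually_nhds by blast
  then have "eventually (\<lambda>w. deriv (C_op \<beta> f) w = C_integrand \<beta> f w) (nhds z)"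
    by eventually_elim (rule d)
  then show "deriv (deriv (C_op \<beta> f)) z = deriv (C_integrand \<beta> f) z"
    by (rule deriv_cong_ev) simp
qed

lemma class_S_nonzero:
  assumes "f \<in> class_S" "z \<in> unit_disk" "z \<noteq> 0" shows "f z \<noteq> 0"
proof -
  have "inj_on f unit_disk" "f 0 = 0" using assms by (auto simp: class_S_def class_A_def)
  moreover have "0 \<in> unit_disk" by (simp add: unit_disk_def)
  ultimately show ?thesis using assms(2,3) unfolding inj_on_def by metis
qed

lemma C_integrand_log_deriv:
  assumes f: "f holomorphic_on unit_disk" and z: "z \<in> unit_disk" "z \<noteq> 0" and fz: "f z \<noteq> 0"
  shows "deriv (C_integrand \<beta> f) z / C_integrand \<beta> f z = deriv f z / f z - 1 / z + of_real \<beta> / (1 - z)"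
proof -
  have op: "open (unit_disk - {0})" by (auto simp: unit_disk_def intro!: open_Diff)
  have nz: "1 - z \<notin> \<real>\<^sub>\<le>\<^sub>0" by (rule one_minus_not_nonpos[OF z(1)])
  then have nz': "1 - z \<noteq> 0" by auto
  have "(f has_field_derivative deriv f z) (at z)"
    using f z by (intro holomorphic_derivI[OF f]) (auto simp: unit_disk_def)
  then have "((\<lambda>w. f w * inverse w * (1 - w) powr (- of_real \<beta>)) has_field_derivative
      (deriv f z * inverse z - f z * inverse z * inverse z) * (1 - z) powr (- of_real \<beta>)
        + f z * inverse z * (of_real \<beta> * (1 - z) powr (- of_real \<beta> - 1))) (at z)"
    using nz z by (auto intro!: derivative_eq_intros simp: algebra_simps)
  then have "(C_integrand \<beta> f has_field_derivative
      (deriv f z * inverse z - f z * inverse z * inverse z) * (1 - z) powr (- of_real \<beta>)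
        + f z * inverse z * (of_real \<beta> * (1 - z) powr (- of_real \<beta> - 1))) (at z)"
    by (rule has_field_derivative_transform_within_open[OF _ op])
       (use z in \<open>auto simp: C_integrand_def powr_minus divide_simps\<close>)
  then have dC: "deriv (C_integrand \<beta> f) z = (deriv f z * inverse z - f z * inverse z * inverse z) * (1 - z) powr (- of_real \<beta>)
        + f z * inverse z * (of_real \<beta> * (1 - z) powr (- of_real \<beta> - 1))" by (rule DERIV_imp_deriv)
  have pd: "(1 - z) powr (- of_real \<beta> - 1) = (1 - z) powr (- of_real \<beta>) / (1 - z)"
    using nz' by (simp add: powr_diff)
  have CC: "C_integrand \<beta> f z = f z * inverse z * (1 - z) powr (- of_real \<beta>)"
    using z by (simp add: C_integrand_def powr_minus divide_simps)
  have pn: "(1 - z) powr (- of_real \<beta>) \<noteq> 0" using nz' by simp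
  have alg: "((d * inverse z - F * inverse z * inverse z) * P + F * inverse z * (b * (P / c))) / (F * inverse z * P)
      = d / F - 1 / z + b / c" if "F \<noteq> 0" "P \<noteq> 0" "c \<noteq> 0" for d F P b c :: complex
    using that z(2) by (simp add: field_simps)
  show ?thesis unfolding dC pd CC by (rule alg[OF fz pn nz'])
qed

text \<open>Both parts of the logarithmic derivative are at most a multiple of
  \<open>1 / (1 - r)\<close>. The factor \<open>1 - r^2\<close> cancels this singularity and leaves
  \<open>(1 + r) * (2 + \<beta>)\<close>.\<close>

lemma preS_quotient_bound:
  assumes \<beta>: "\<beta> \<ge> 0" and f: "f \<in> class_S" and z: "z \<in> unit_disk" "z \<noteq> 0"
  shows "(1 - (cmod z)\<^sup>2) * cmod (deriv (C_integrand \<beta> f) z / C_integrand \<beta> f z) \<le> 4 + 2 * \<beta>"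
proof -
  have fh: "f holomorphic_on unit_disk" "f 0 = 0" "inj_on f unit_disk" using f by (auto simp: class_S_def class_A_def)
  have fz: "f z \<noteq> 0" by (rule class_S_nonzero[OF f z])
  define r where "r = cmod z"
  have r: "0 < r" "r < 1" using z by (auto simp: r_def unit_disk_def)
  have "deriv f z / f z - 1 / z = (z * deriv f z / f z - 1) / z" using z fz by (simp add: field_simps)
  then have "cmod (deriv f z / f z - 1 / z) = cmod (z * deriv f z / f z - 1) / r" by (simp add: norm_divide r_def)
  also have "\<dots> \<le> (2 * r / (1 - r)) / r"
    using log_deriv_bound_univalent[of f z] fh z r by (intro divide_right_mono) (auto simp: r_def unit_disk_def)
  also have "\<dots> = 2 / (1 - r)" using r by simp
  finally have b1: "cmod (deriv f z / f z - 1 / z) \<le> 2 / (1 - r)" .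
  have "1 - r \<le> cmod (1 - z)" using norm_triangle_ineq2[of 1 z] by (simp add: r_def)
  then have b2: "cmod (of_real \<beta> / (1 - z)) \<le> \<beta> / (1 - r)"
    using r \<beta> by (auto simp: norm_divide intro!: divide_left_mono mult_pos_pos)
  have "cmod (deriv (C_integrand \<beta> f) z / C_integrand \<beta> f z) \<le> 2 / (1 - r) + \<beta> / (1 - r)"
    unfolding C_integrand_log_deriv[OF fh(1) z fz] using b1 b2 by (intro norm_triangle_mono)
  then have "(1 - r\<^sup>2) * cmod (deriv (C_integrand \<beta> f) z / C_integrand \<beta> f z) \<le> (1 - r\<^sup>2) * (2 / (1 - r) + \<beta> / (1 - r))"
    using r by (intro mult_left_mono) (auto simp: power_le_one)
  also have "\<dots> = (1 + r) * (1 - r) * ((2 + \<beta>) / (1 - r))"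
    by (simp add: add_divide_distrib power2_eq_square algebra_simps)
  also have "\<dots> = (1 + r) * (2 + \<beta>)" using r by simp
  also have "\<dots> \<le> 2 * (2 + \<beta>)" using r \<beta> by (intro mult_right_mono) auto
  finally show ?thesis by (simp add: r_def)
qed

lemma C_integrand_nonzero:
  assumes f: "f \<in> class_S" and z: "z \<in> unit_disk"
  shows "C_integrand \<beta> f z \<noteq> 0"
  using class_S_nonzero[OF f z] one_minus_not_nonpos[OF z] f
  by (auto simp: C_integrand_def class_S_def class_A_def)

text \<open>At the origin the formula \<open>f'/f - 1/z\<close> is meaningless, so the bound is
  extended there by continuity of the quotient formed with \<open>C_integrand\<close>.\<close>

lemma preS_quotient_bound_disk:
  assumes \<beta>: "\<beta> \<ge> 0" and f: "f \<in> class_S" and z: "z \<in> unit_disk"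
  shows "(1 - (cmod z)\<^sup>2) * cmod (deriv (C_integrand \<beta> f) z / C_integrand \<beta> f z) \<le> 4 + 2 * \<beta>"
proof (cases "z = 0")
  case True
  let ?q = "\<lambda>z. (1 - (cmod z)\<^sup>2) * cmod (deriv (C_integrand \<beta> f) z / C_integrand \<beta> f z)"
  have op: "open unit_disk" by (simp add: unit_disk_def)
  have Ph: "C_integrand \<beta> f holomorphic_on unit_disk"
    using f by (intro C_integrand_holomorphic) (auto simp: class_S_def class_A_def)
  have "continuous_on unit_disk ?q"
    using C_integrand_nonzero[OF f]
    by (intro continuous_intros holomorphic_on_imp_continuous_on[OF Ph]
        holomorphic_on_imp_continuous_on[OF holomorphic_deriv[OF Ph op]]) auto
  then have "isCont ?q 0" using z True continuous_on_eq_continuous_at[OF op] by blast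
  then have "(?q \<longlongrightarrow> ?q 0) (at 0)" by (rule isContD)
  moreover have "eventually (\<lambda>w. ?q w \<le> 4 + 2 * \<beta>) (at 0)"
    using op z True preS_quotient_bound[OF \<beta> f] by (auto simp: eventually_at_topological)
  ultimately have "?q 0 \<le> 4 + 2 * \<beta>" by (rule tendsto_upperbound) simp
  then show ?thesis using True by simp
qed (use preS_quotient_bound[OF \<beta> f z] in simp)

lemma preS_norm_C_op:
  assumes "f \<in> class_S"
  shows "preS_norm (C_op \<beta> f) = (SUP z\<in>unit_disk. ereal ((1 - (cmod z)\<^sup>2) * cmod (deriv (C_integrand \<beta> f) z / C_integrand \<beta> f z)))"
proof -
  have f: "f holomorphic_on unit_disk" "f 0 = 0" using assms by (auto simp: class_S_def class_A_def)
  show ?thesis unfolding preS_norm_def by (intro SUP_cong refl) (simp add: C_op_derivs[OF f])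
qed

section \<open>The Koebe function and sharpness\<close>

definition koebe :: "complex \<Rightarrow> complex" where
  "koebe z = z / (1 - z)\<^sup>2"

lemma koebe_has_derivative:
  assumes "z \<noteq> 1"
  shows "(koebe has_field_derivative (1 + z) / (1 - z) ^ 3) (at z)"
proof -
  have nz: "1 - z \<noteq> 0" using assms by simp
  have "(koebe has_field_derivative ((1 - z)\<^sup>2 - z * (2 * (1 - z) * (- 1))) / ((1 - z)\<^sup>2 * (1 - z)\<^sup>2)) (at z)"
    unfolding koebe_def using nz by (auto intro!: derivative_eq_intros)
  moreover have "((1 - z)\<^sup>2 - z * (2 * (1 - z) * (- 1))) = (1 - z) * (1 + z)"
    by (simp add: power2_eq_square algebra_simps)
  moreover have "(1 - z)\<^sup>2 * (1 - z)\<^sup>2 = (1 - z) * (1 - z) ^ 3"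
    by (simp add: power2_eq_square power3_eq_cube)
  ultimately show ?thesis using nz by simp
qed

lemma koebe_in_class_S: "koebe \<in> class_S"
proof -
  have ne: "z \<noteq> 1" if "z \<in> unit_disk" for z using that by (auto simp: unit_disk_def)
  have op: "open unit_disk" by (simp add: unit_disk_def)
  have "koebe holomorphic_on unit_disk"
    unfolding holomorphic_on_open[OF op] using koebe_has_derivative ne by blast
  moreover have "deriv koebe 0 = 1"
    using DERIV_imp_deriv[OF koebe_has_derivative[of 0]] by simp
  moreover have "inj_on koebe unit_disk"
  proof (rule inj_onI)
    fix x y assume x: "x \<in> unit_disk" and y: "y \<in> unit_disk" and eq: "koebe x = koebe y"
    have "x * (1 - y)\<^sup>2 = y * (1 - x)\<^sup>2"
      using eq ne[OF x] ne[OF y] by (simp add: koebe_def frac_eq_eq)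
    then have "(x - y) * (1 - x * y) = 0" by (simp add: power2_eq_square algebra_simps)
    moreover have "1 - x * y \<noteq> 0"
    proof
      assume "1 - x * y = 0"
      then have "cmod x * cmod y = 1" by (metis eq_iff_diff_eq_0 norm_mult norm_one)
      moreover have "cmod x * cmod y < 1 * 1"
        using x y by (intro mult_strict_mono) (auto simp: unit_disk_def)
      ultimately show False by simp
    qed
    ultimately show "x = y" by simp
  qed
  ultimately show ?thesis by (simp add: class_S_def class_A_def koebe_def)
qed

text \<open>On the positive radius the logarithmic derivative is
  \<open>2 / (1 - x) + \<beta> / (1 - x)\<close>. The terms are nonnegative reals, so every estimate
  behind the factor \<open>(1 + r) * (2 + \<beta>)\<close> becomes an equality.\<close>

lemma koebe_C_integrand_log_deriv:
  assumes x: "0 < x" "x < (1::real)" and \<beta>: "\<beta> \<ge> 0"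
  shows "(1 - (cmod x)\<^sup>2) * cmod (deriv (C_integrand \<beta> koebe) x / C_integrand \<beta> koebe x) = (1 + x) * (2 + \<beta>)"
proof -
  let ?z = "complex_of_real x"
  have z: "?z \<in> unit_disk" "?z \<noteq> 0" "?z \<noteq> 1" using x by (auto simp: unit_disk_def)
  have nz: "1 - ?z \<noteq> 0" using z by simp
  have kh: "koebe holomorphic_on unit_disk" using koebe_in_class_S by (auto simp: class_S_def class_A_def)
  have kz: "koebe ?z \<noteq> 0" using z by (simp add: koebe_def)
  have "deriv koebe ?z / koebe ?z - 1 / ?z = (1 + ?z) / ((1 - ?z) * ?z) - 1 / ?z"
    using DERIV_imp_deriv[OF koebe_has_derivative[OF z(3)]] nz z
    by (simp add: koebe_def power2_eq_square power3_eq_cube)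
  also have "\<dots> = 2 / (1 - ?z)" using nz z by (simp add: field_simps)
  finally have "deriv (C_integrand \<beta> koebe) ?z / C_integrand \<beta> koebe ?z = 2 / (1 - ?z) + of_real \<beta> / (1 - ?z)"
    unfolding C_integrand_log_deriv[OF kh z(1,2) kz] by simp
  also have "\<dots> = of_real ((2 + \<beta>) / (1 - x))" by (simp add: add_divide_distrib)
  finally have "cmod (deriv (C_integrand \<beta> koebe) ?z / C_integrand \<beta> koebe ?z) = (2 + \<beta>) / (1 - x)"
    using x \<beta> by (simp only: norm_of_real) simp
  moreover have "1 - (cmod ?z)\<^sup>2 = (1 + x) * (1 - x)" by (simp add: power2_eq_square algebra_simps)
  ultimately show ?thesis using x by simp
qed

text \<open>Membership in \<open>class_A\<close> and the nonvanishing derivative certify that the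
  norm is taken of an admissible function; since division by zero gives 0, \<open>preS_norm\<close>
  alone would not reveal a zero of the derivative.\<close>

theorem theorem3p5:
  fixes \<beta> :: real
  assumes "\<beta> \<ge> 0"
  shows "(\<forall>f\<in>class_S. C_op \<beta> f \<in> class_A \<and> (\<forall>z\<in>unit_disk. deriv (C_op \<beta> f) z \<noteq> 0)
            \<and> preS_norm (C_op \<beta> f) \<le> ereal (4 + 2 * \<beta>))
       \<and> (\<exists>f\<in>class_S. preS_norm (C_op \<beta> f) = ereal (4 + 2 * \<beta>))"
proof -
  have upper: "preS_norm (C_op \<beta> f) \<le> ereal (4 + 2 * \<beta>)" if f: "f \<in> class_S" for f
    unfolding preS_norm_C_op[OF f]
    by (intro SUP_least) (use preS_quotient_bound_disk[OF assms f] in simp)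
  have "C_op \<beta> f \<in> class_A \<and> (\<forall>z\<in>unit_disk. deriv (C_op \<beta> f) z \<noteq> 0)" if fS: "f \<in> class_S" for f
  proof -
    have f: "f holomorphic_on unit_disk" "f 0 = 0" "deriv f 0 = 1" using fS by (auto simp: class_S_def class_A_def)
    have op: "open unit_disk" "0 \<in> unit_disk" by (auto simp: unit_disk_def)
    have "C_op \<beta> f holomorphic_on unit_disk"
      unfolding holomorphic_on_open[OF op(1)] using C_op_has_derivative[OF f(1,2)] by blast
    moreover have "C_op \<beta> f 0 = 0" by (simp add: C_op_def)
    moreover have "deriv (C_op \<beta> f) 0 = 1"
      using C_op_derivs(1)[OF f(1,2) op(2)] f(3) by (simp add: C_integrand_def)
    moreover have "deriv (C_op \<beta> f) z \<noteq> 0" if "z \<in> unit_disk" for z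
      using C_op_derivs(1)[OF f(1,2) that] C_integrand_nonzero[OF fS that] by simp
    ultimately show ?thesis by (simp add: class_A_def)
  qed
  moreover have "ereal (4 + 2 * \<beta>) \<le> preS_norm (C_op \<beta> koebe)"
  \<comment> \<open>Along the positive radius the values \<open>(1 + x) * (2 + \<beta>)\<close> only
    approach \<open>4 + 2 * \<beta>\<close> as \<open>x\<close> tends to 1, so the supremum is
    bounded from below by a limit.\<close>
  proof (rule tendsto_upperbound)
    have "((\<lambda>x. (1 + x) * (2 + \<beta>)) \<longlongrightarrow> (1 + 1) * (2 + \<beta>)) (at_left (1::real))"
      by (intro tendsto_intros)
    then show "((\<lambda>x. ereal ((1 + x) * (2 + \<beta>))) \<longlongrightarrow> ereal (4 + 2 * \<beta>)) (at_left (1::real))"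
      by (simp add: algebra_simps)
    have "eventually (\<lambda>x. x \<in> {0<..<1}) (at_left (1::real))"
      by (rule eventually_at_left_real) simp
    then show "eventually (\<lambda>x. ereal ((1 + x) * (2 + \<beta>)) \<le> preS_norm (C_op \<beta> koebe)) (at_left (1::real))"
    proof eventually_elim
      case (elim x)
      then have "complex_of_real x \<in> unit_disk" by (simp add: unit_disk_def)
      then show ?case
        unfolding preS_norm_C_op[OF koebe_in_class_S]
        using elim koebe_C_integrand_log_deriv[of x \<beta>] assms
        by (intro SUP_upper2[of "complex_of_real x"]) auto
    qed
  qed simp
  ultimately show ?thesis using upper koebe_in_class_S by (meson order_antisym)
qed

end
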